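(* Consider the dual gradient flow $$x(t)=\nabla\mathcal R^*(A^*\lambda(t)),\qquad \frac{d}{dt}\lambda(t)=y^\delta-Ax(t),\quad t>0,$$ with $\lambda(0)=0$, driven by noisy data $y^\delta$ with $\|y^\delta-y\|\le\delta$. Let $\tau>1$ and let $t_\delta$ be chosen by the discrepancy principle: if $\|Ax(0)-y^\delta\|\le\tau\delta$, set $t_\delta:=0$; otherwise let $t_\delta>0$ be a number such that $\|Ax(t_\delta)-y^\delta\|=\tau\delta$. Then this rule outputs a finite number $t_\delta$, and $$\mathcal R(x(t_\delta))\to\mathcal R(x^\dagger)\quad\text{and}\quad D_{\mathcal R}^{\xi(t_\delta)}(x^\dagger,x(t_\delta))\to0\qquad\text{as }\delta\to0,$$ where $\xi(t):=A^*\lambda(t)$. Consequently $\|x(t_\delta)-x^\dagger\|\to0$ as $\delta\to0$.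
   Context: Standing setting. $X$ is a Banach space, $Y$ is a Hilbert space (identified with its dual), $A:X\to Y$ is a bounded linear operator with adjoint $A^*:Y\to X^*$. $\mathcal R:X\to(-\infty,\infty]$ is proper, lower semi-continuous, and strongly convex in the sense that there is a constant $c_0>0$ with $$\mathcal R(\gamma x+(1-\gamma)x')+c_0\gamma(1-\gamma)\|x-x'\|^2\le\gamma\mathcal R(x)+(1-\gamma)\mathcal R(x')$$ for all $x,x'\in\mathrm{dom}(\mathcal R)$ and $0\le\gamma\le1$; moreover each sublevel set of $\mathcal R$ is weakly compact in $X$. Here $\mathrm{dom}(\mathcal R)=\{x:\mathcal R(x)<\infty\}$. The exact datum $y\in Y$ is such that $Ax=y$ has a solution in $\mathrm{dom}(\mathcal R)$. Under these assumptions there is a unique $\mathcal R$-minimizing solution $x^\dagger$, i.e. $Ax^\dagger=y$ and $\mathcal R(x^\dagger)=\min\{\mathcal R(x):x\in X,\ Ax=y\}$. Noisy data: for each noise level $\delta>0$, $y^\delta\in Y$ satisfies $\|y^\delta-y\|\le\delta$; the flow (and so $x(t)$, $\lambda(t)$) depends on $y^\delta$, although this is suppressed in the notation. $\mathcal R^*(\xi):=\sup_{x\in X}\{\langle\xi,x\rangle-\mathcal R(x)\}$, $\xi\in X^*$, is the Legendre–Fenchel conjugate. Under the assumptions $\mathcal R^*$ is finite and Fréchet differentiable on $X^*$, with $\nabla\mathcal R^*:X^*\to X$ Lipschitz continuous, and for any initial value $\lambda(0)\in Y$ the flow has a unique solution $(x,\lambda)\in C([0,\infty),X)\times C^1([0,\infty),Y)$.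 One has $A^*\lambda(t)\in\partial\mathcal R(x(t))$, where $\partial\mathcal R(x)=\{\xi\in X^*:\mathcal R(x')\ge\mathcal R(x)+\langle\xi,x'-x\rangle\ \forall x'\in X\}$. Bregman distance: for $\xi\in\partial\mathcal R(x)$, $D_{\mathcal R}^{\xi}(x',x):=\mathcal R(x')-\mathcal R(x)-\langle\xi,x'-x\rangle$. *)

theory Defs
  imports "HOL-Analysis.Analysis"
begin

text \<open>
  The dual space of a real normed space \<open>'a\<close> is \<open>'a \<Rightarrow>\<^sub>L real\<close>; extended-real-valued functionals
  take values in \<^typ>\<open>ereal\<close>.
\<close>

definition weak_topology :: "'a::real_normed_vector topology" where
  "weak_topology =
     topology_generated_by {blinfun_apply \<xi> -` U | (\<xi> :: 'a \<Rightarrow>\<^sub>L real) U. open U}"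

definition effective_domain :: "('a \<Rightarrow> ereal) \<Rightarrow> 'a set" where
  "effective_domain R = {x. R x < \<infinity>}"

definition proper_functional :: "('a \<Rightarrow> ereal) \<Rightarrow> bool" where
  "proper_functional R \<longleftrightarrow> (\<forall>x. R x \<noteq> -\<infinity>) \<and> effective_domain R \<noteq> {}"

definition lower_semicontinuous :: "('a::topological_space \<Rightarrow> ereal) \<Rightarrow> bool" where
  "lower_semicontinuous R \<longleftrightarrow> (\<forall>x. R x \<le> Liminf (at x) R)"

definition strongly_convex :: "('a::real_normed_vector \<Rightarrow> ereal) \<Rightarrow> bool" where
  "strongly_convex R \<longleftrightarrow>
     (\<exists>c0>0. \<forall>x\<in>effective_domain R. \<forall>x'\<in>effective_domain R. \<forall>\<gamma>\<in>{0..1}.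
        R (\<gamma> *\<^sub>R x + (1 - \<gamma>) *\<^sub>R x') + ereal (c0 * \<gamma> * (1 - \<gamma>) * (norm (x - x'))\<^sup>2)
          \<le> ereal \<gamma> * R x + ereal (1 - \<gamma>) * R x')"

text \<open>Only real levels are meant: the level \<open>\<infinity>\<close> would give the whole space.\<close>

definition weakly_compact_sublevels :: "('a::real_normed_vector \<Rightarrow> ereal) \<Rightarrow> bool" where
  "weakly_compact_sublevels R \<longleftrightarrow> (\<forall>c::real. compactin weak_topology {x. R x \<le> ereal c})"

text \<open>The Banach space adjoint, with the Hilbert space identified with its own dual.\<close>

definition dual_adjoint ::
  "('a::real_normed_vector \<Rightarrow>\<^sub>L 'b::real_inner) \<Rightarrow> 'b \<Rightarrow> ('a \<Rightarrow>\<^sub>L real)" where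
  "dual_adjoint A \<eta> = blinfun_inner_right \<eta> o\<^sub>L A"

definition conjugate :: "('a::real_normed_vector \<Rightarrow> ereal) \<Rightarrow> ('a \<Rightarrow>\<^sub>L real) \<Rightarrow> ereal" where
  "conjugate R \<xi> = (SUP x. ereal (\<xi> x) - R x)"

text \<open>
  The Frechet derivative of \<open>conjugate R\<close> at \<open>\<xi>\<close> lives in the bidual; the gradient is the point
  of \<open>'a\<close> that represents it. For the functionals considered here the conjugate is finite
  everywhere, so \<^const>\<open>real_of_ereal\<close> is only a change of type.
\<close>

definition conjugate_gradient ::
  "('a::real_normed_vector \<Rightarrow> ereal) \<Rightarrow> ('a \<Rightarrow>\<^sub>L real) \<Rightarrow> 'a" where
  "conjugate_gradient R \<xi> =
     (THE x. ((\<lambda>\<zeta>. real_of_ereal (conjugate R \<zeta>)) has_derivative (\<lambda>\<zeta>. blinfun_apply \<zeta> x)) (at \<xi>))"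

definition bregman_distance ::
  "('a::real_normed_vector \<Rightarrow> ereal) \<Rightarrow> ('a \<Rightarrow>\<^sub>L real) \<Rightarrow> 'a \<Rightarrow> 'a \<Rightarrow> ereal" where
  "bregman_distance R \<xi> x' x = R x' - R x - ereal (\<xi> (x' - x))"

text \<open>
  At \<open>t = 0\<close> the derivative is one-sided. Since \<open>x\<close> is continuous, the differential equation
  makes \<open>lam\<close> continuously differentiable on \<open>[0, \<infinity>)\<close>.
\<close>

definition dual_gradient_flow ::
  "('a::real_normed_vector \<Rightarrow> ereal) \<Rightarrow> ('a \<Rightarrow>\<^sub>L 'b::real_inner) \<Rightarrow> 'b \<Rightarrow>
     (real \<Rightarrow> 'a) \<Rightarrow> (real \<Rightarrow> 'b) \<Rightarrow> bool" where
  "dual_gradient_flow R A v x lam \<longleftrightarrow>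
     continuous_on {0..} x \<and>
     lam 0 = 0 \<and>
     (\<forall>t\<ge>0. x t = conjugate_gradient R (dual_adjoint A (lam t))) \<and>
     (\<forall>t\<ge>0. (lam has_vector_derivative (v - A (x t))) (at t within {0..}))"

text \<open>
  \<open>T\<close> is an admissible outcome of the discrepancy principle for the data \<open>v\<close> with noise level
  \<open>\<delta>\<close>; the rule need not determine \<open>T\<close> uniquely.
\<close>

definition discrepancy_time ::
  "('a::real_normed_vector \<Rightarrow>\<^sub>L 'b::real_normed_vector) \<Rightarrow> real \<Rightarrow> real \<Rightarrow> 'b \<Rightarrow>
     (real \<Rightarrow> 'a) \<Rightarrow> real \<Rightarrow> bool" where
  "discrepancy_time A \<tau> \<delta> v x T \<longleftrightarrow>
     (if norm (A (x 0) - v) \<le> \<tau> * \<delta> then T = 0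
      else T > 0 \<and> norm (A (x T) - v) = \<tau> * \<delta>)"

end

theory Submission
  imports Defs
begin

text \<open>
  Write \<open>d\<^sub>w \<mu> = R\<^sup>* (A\<^sup>* \<mu>) - \<langle>\<mu>, w\<rangle>\<close>. The flow is the gradient flow of the convex function \<open>d\<^sub>v\<close> for
  the noisy data \<open>v\<close>, and the Bregman distance of \<open>xdag\<close> and \<open>x t\<close> is the duality gap
  \<open>\<eta> t = R xdag + d\<^sub>y (lam t) \<ge> 0\<close> for the exact data \<open>y\<close>. So the claim is that the flow, stopped by the
  discrepancy principle, almost minimizes the wrong function \<open>d\<^sub>y\<close>.
  
  Three facts about the flow are used. The residual \<open>r = norm (A x - v)\<close> does not increase, because
  trajectories of a convex gradient flow do not separate. Since \<open>\<eta>' \<le> - r * (r - \<delta>)\<close>, the gap decreases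
  as long as \<open>r \<ge> \<tau> * \<delta>\<close>; then even \<open>(\<tau> - 1) * \<delta> * norm (lam t - lam s) \<le> \<eta> s - \<eta> t\<close>. A linear
  variant of this estimate shows that a stopping time exists, as \<open>\<eta>\<close> cannot become negative. Finally,
  as long as \<open>d\<^sub>v (lam t) \<ge> d\<^sub>v \<mu>\<close> the flow, started at \<open>0\<close>, does not move away from \<open>\<mu>\<close>, so that \<open>norm (lam t) \<le> 2 * norm \<mu>\<close>.
  
  The infimum of \<open>d\<^sub>y\<close> is \<open>- R xdag\<close> (\<open>strong_duality\<close>), but it need not be attained. So one fixes an
  \<open>\<epsilon>\<close>-optimal \<open>\<mu>\<close>, independent of \<open>\<delta>\<close>, and compares the flow with it. If the flow reaches the level
  \<open>d\<^sub>v \<mu>\<close> at a time \<open>s\<close> before it is stopped, then \<open>\<eta> s \<le> \<epsilon> + O(\<delta>)\<close>, the gap is no larger at the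
  stopping time, and the displacement of \<open>lam\<close> after \<open>s\<close> is \<open>(\<epsilon> + O(\<delta>)) / ((\<tau> - 1) * \<delta>)\<close>. If not, \<open>lam\<close> is
  bounded at the stopping time, and there the residual is at most \<open>\<tau> * \<delta>\<close>, so that primal and dual values
  agree up to \<open>\<epsilon> + O(\<delta>)\<close>. In both cases \<open>\<eta>\<close> and \<open>\<delta> * norm lam\<close> are bounded by a multiple of \<open>\<epsilon>\<close> plus
  \<open>O(\<delta>)\<close> (\<open>stopping_estimate\<close>). This gives the convergence of the Bregman distance and, through
  \<open>R (x t) = R xdag - \<eta> t - \<langle>lam t, y - A (x t)\<rangle>\<close>, of the values of \<open>R\<close>. Strong convexity
  bounds \<open>c * (norm (x t - xdag))\<^sup>2\<close> by \<open>\<eta> t\<close>.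
  
  Every minimization needed on the way is solved by completeness: minimizing sequences of strongly
  convex functionals are Cauchy. The Hahn-Banach theorem enters only through the uniqueness of the
  point that represents the derivative of the conjugate.
\<close>

section \<open>Separation of points by the dual space\<close>

definition sublinear :: "('a::real_vector \<Rightarrow> real) \<Rightarrow> bool" where
  "sublinear p \<longleftrightarrow> (\<forall>x z. p (x + z) \<le> p x + p z) \<and> (\<forall>t\<ge>0. \<forall>x. p (t *\<^sub>R x) = t * p x)"

text \<open>
  Lowering \<open>p\<close> as far as possible in the direction \<open>-w\<close>: this is the largest sublinear functional
  below \<open>p\<close> whose value at \<open>-w\<close> is at most \<open>- p w\<close>, so that a minimal \<open>p\<close> must agree with it.
\<close>

definition directional_reduction :: "('a::real_vector \<Rightarrow> real) \<Rightarrow> 'a \<Rightarrow> 'a \<Rightarrow> real" where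
  "directional_reduction p w x = (INF t\<in>{0..}. p (x + t *\<^sub>R w) - t * p w)"

lemma sublinearD:
  assumes "sublinear p"
  shows "p (x + z) \<le> p x + p z" "t \<ge> 0 \<Longrightarrow> p (t *\<^sub>R x) = t * p x" "p 0 = 0" "- p (- x) \<le> p x"
proof -
  show a: "p (x + z) \<le> p x + p z" for x z using assms by (simp add: sublinear_def)
  show b: "p (t *\<^sub>R x) = t * p x" if "t \<ge> 0" for t x using assms that by (simp add: sublinear_def)
  show c: "p 0 = 0" using b[of 0 0] by simp
  show "- p (- x) \<le> p x" using a[of x "-x"] c by simp
qed

lemma directional_reduction_bounded_below:
  assumes p: "sublinear p" and "t \<ge> 0"
  shows "- p (- x) \<le> p (x + t *\<^sub>R w) - t * p w"
  using sublinearD(1)[OF p, of "x + t *\<^sub>R w" "-x"] sublinearD(2)[OF p \<open>t \<ge> 0\<close>, of w] by simp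

lemma directional_reduction_le:
  assumes p: "sublinear p" and "t \<ge> 0"
  shows "directional_reduction p w x \<le> p (x + t *\<^sub>R w) - t * p w"
  unfolding directional_reduction_def
  by (rule cINF_lower) (auto intro!: bdd_belowI2[where m = "- p (- x)"]
      directional_reduction_bounded_below[OF p] simp: assms)

lemma directional_reduction_greatest:
  assumes "\<And>t. t \<ge> 0 \<Longrightarrow> m \<le> p (x + t *\<^sub>R w) - t * p w"
  shows "m \<le> directional_reduction p w x"
  unfolding directional_reduction_def by (rule cINF_greatest) (auto simp: assms)

lemma sublinear_directional_reduction:
  assumes p: "sublinear p"
  shows "sublinear (directional_reduction p w)"
  unfolding sublinear_def
proof (intro conjI allI impI)
  let ?q = "directional_reduction p w"
  fix x z
  have "?q (x + z) - (p (z + t *\<^sub>R w) - t * p w) \<le> ?q x" if t: "t \<ge> 0" for t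
  proof (rule directional_reduction_greatest)
    fix s :: real assume s: "s \<ge> 0"
    have "?q (x + z) \<le> p ((x + z) + (s + t) *\<^sub>R w) - (s + t) * p w"
      using s t by (intro directional_reduction_le[OF p]) auto
    also have "(x + z) + (s + t) *\<^sub>R w = (x + s *\<^sub>R w) + (z + t *\<^sub>R w)"
      by (simp add: algebra_simps)
    finally show "?q (x + z) - (p (z + t *\<^sub>R w) - t * p w) \<le> p (x + s *\<^sub>R w) - s * p w"
      using sublinearD(1)[OF p, of "x + s *\<^sub>R w" "z + t *\<^sub>R w"] by (simp add: algebra_simps)
  qed
  then have "?q (x + z) - ?q x \<le> ?q z"
    by (intro directional_reduction_greatest) (simp add: algebra_simps)
  then show "?q (x + z) \<le> ?q x + ?q z" by simp
next
  let ?q = "directional_reduction p w"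
  fix a :: real and x assume a: "a \<ge> 0"
  have le: "?q (b *\<^sub>R u) \<le> b * ?q u" if b: "b > 0" for b u
  proof -
    have "?q (b *\<^sub>R u) / b \<le> ?q u"
    proof (rule directional_reduction_greatest)
      fix t :: real assume t: "t \<ge> 0"
      have "?q (b *\<^sub>R u) \<le> p (b *\<^sub>R u + (b * t) *\<^sub>R w) - (b * t) * p w"
        using b t by (intro directional_reduction_le[OF p]) auto
      also have "b *\<^sub>R u + (b * t) *\<^sub>R w = b *\<^sub>R (u + t *\<^sub>R w)" by (simp add: algebra_simps)
      also have "p (b *\<^sub>R (u + t *\<^sub>R w)) = b * p (u + t *\<^sub>R w)"
        using b by (intro sublinearD(2)[OF p]) simp
      finally have "?q (b *\<^sub>R u) \<le> b * (p (u + t *\<^sub>R w) - t * p w)"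
        by (simp add: right_diff_distrib)
      then show "?q (b *\<^sub>R u) / b \<le> p (u + t *\<^sub>R w) - t * p w"
        using b by (simp add: field_simps)
    qed
    then show ?thesis using b by (simp add: field_simps)
  qed
  show "?q (a *\<^sub>R x) = a * ?q x"
  proof (cases "a = 0")
    case True
    have "?q 0 \<le> 0" using directional_reduction_le[OF p, of 0 w 0] by (simp add: sublinearD(3)[OF p])
    moreover have "0 \<le> ?q 0"
      by (rule directional_reduction_greatest) (simp add: sublinearD(2)[OF p])
    ultimately show ?thesis using True by simp
  next
    case False
    with a have "a > 0" by simp
    with le[of a x] le[of "1/a" "a *\<^sub>R x"] show ?thesis by (simp add: field_simps)
  qed
qed

text \<open>
  Zorn's lemma on everywhere defined functionals, ordered pointwise from above. A chain
  has the pointwise infimum as a lower bound, which is finite because every member \<open>q\<close> satisfies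
  \<open>q x \<ge> - q (-x) \<ge> - p (-x)\<close>.
\<close>

lemma minimal_sublinear_exists:
  assumes p: "sublinear p"
  obtains q where "sublinear q" "q \<le> p" "\<And>q'. sublinear q' \<Longrightarrow> q' \<le> q \<Longrightarrow> q' = q"
proof -
  let ?S = "{q. sublinear q \<and> q \<le> p}"
  have "\<exists>m\<in>?S. \<forall>a\<in>?S. a \<le> m \<longrightarrow> a = m"
  proof (rule predicate_Zorn[where P = "\<lambda>q q'. q' \<le> q"])
    show "partial_order_on ?S (relation_of (\<lambda>q q'. q' \<le> q) ?S)"
      by (rule partial_order_on_relation_ofI) auto
  next
    fix C assume C: "C \<in> Chains (relation_of (\<lambda>q q'. q' \<le> q) ?S)"
    then have CS: "C \<subseteq> ?S" and tot: "\<And>q q'. q \<in> C \<Longrightarrow> q' \<in> C \<Longrightarrow> q \<le> q' \<or> q' \<le> q"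
      by (auto simp: Chains_def relation_of_def)
    show "\<exists>u\<in>?S. \<forall>a\<in>C. u \<le> a"
    proof (cases "C = {}")
      case True then show ?thesis using p by auto
    next
      case False
      have sub: "sublinear q" "q \<le> p" if "q \<in> C" for q using CS that by auto
      have low: "- p (- x) \<le> q x" if "q \<in> C" for q x
        using sublinearD(4)[OF sub(1)[OF that], of x] le_funD[OF sub(2)[OF that], of "-x"] by simp
      define u where "u = (\<lambda>x. INF q\<in>C. q x)"
      have u_le: "u x \<le> q x" if "q \<in> C" for q x
        unfolding u_def using low that by (intro cINF_lower bdd_belowI2[where m = "- p (- x)"]) auto
      have u_ge: "m \<le> u x" if "\<And>q. q \<in> C \<Longrightarrow> m \<le> q x" for m x
        unfolding u_def using False that by (intro cINF_greatest) auto
      have "u (x + z) \<le> u x + u z" for x z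
      proof -
        \<comment> \<open>Two members of the chain are comparable, so the smaller one serves for both summands.\<close>
        have "u (x + z) - q z \<le> u x" if q: "q \<in> C" for q
        proof (rule u_ge)
          fix q' assume q': "q' \<in> C"
          have "u (x + z) \<le> q' x + q z"
          proof (cases "q \<le> q'")
            case True
            then show ?thesis
              using u_le[OF q, of "x + z"] sublinearD(1)[OF sub(1)[OF q], of x z] le_funD[OF True, of x] by simp
          next
            case False
            then have "q' \<le> q" using tot[OF q q'] by simp
            then show ?thesis
              using u_le[OF q', of "x + z"] sublinearD(1)[OF sub(1)[OF q'], of x z]
                le_funD[OF \<open>q' \<le> q\<close>, of z] by simp
          qed
          then show "u (x + z) - q z \<le> q' x" by simp
        qed
        then have "u (x + z) - u x \<le> u z" by (intro u_ge) (simp add: algebra_simps)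
        then show ?thesis by simp
      qed
      moreover have "u (a *\<^sub>R x) = a * u x" if a: "a \<ge> 0" for a x
      proof (cases "a = 0")
        case True
        then show ?thesis unfolding u_def using False by (simp add: sublinearD(3)[OF sub(1)] cong: INF_cong)
      next
        case False
        with a have a: "a > 0" by simp
        have "u (a *\<^sub>R x) / a \<le> u x"
          using a u_le[of _ "a *\<^sub>R x"]
          by (intro u_ge) (simp add: field_simps sublinearD(2)[OF sub(1)])
        moreover have "a * u x \<le> u (a *\<^sub>R x)"
          using a u_le[of _ x] by (intro u_ge) (simp add: sublinearD(2)[OF sub(1)])
        ultimately show ?thesis using a by (simp add: field_simps)
      qed
      ultimately have "sublinear u" by (simp add: sublinear_def)
      moreover have "u \<le> p"
        using False u_le sub(2) by (metis (no_types, opaque_lifting) equals0I le_funD le_funI order_trans)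
      ultimately show ?thesis using u_le by (auto simp: le_fun_def)
    qed
  qed
  then show ?thesis using that by (smt (verit) mem_Collect_eq order_trans)
qed

text \<open>
  By minimality \<open>q\<close> equals its reduction in every direction \<open>w\<close>; the term \<open>t = 1\<close> of the infimum then
  gives \<open>q x + q w \<le> q (x + w)\<close>, the missing half of additivity.
\<close>

lemma minimal_sublinear_linear:
  assumes q: "sublinear q" and min: "\<And>q'. sublinear q' \<Longrightarrow> q' \<le> q \<Longrightarrow> q' = q"
  shows "linear q"
proof -
  have add: "q (x + w) = q x + q w" for x w
  proof -
    have "directional_reduction q w \<le> q"
      using directional_reduction_le[OF q, of 0 w] by (intro le_funI) simp
    then have "directional_reduction q w = q"
      by (intro min sublinear_directional_reduction q)
    then have "q x \<le> q (x + w) - q w" using directional_reduction_le[OF q, of 1 w x] by simp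
    with sublinearD(1)[OF q, of x w] show ?thesis by simp
  qed
  have neg: "q (- x) = - q x" for x using add[of x "-x"] sublinearD(3)[OF q] by simp
  show ?thesis
  proof (rule linearI[OF add])
    fix a x show "q (a *\<^sub>R x) = a *\<^sub>R q x"
      using sublinearD(2)[OF q, of a x] sublinearD(2)[OF q, of "-a" "x"] neg[of "a *\<^sub>R x"]
      by (cases "a \<ge> 0") auto
  qed
qed

text \<open>
  The form of the Hahn-Banach theorem that makes the gradient of the conjugate a well-defined point
  of the space. The norm is reduced in the direction \<open>w = x - z\<close> first: a linear functional below the
  result is bounded by the norm and takes a value \<open>\<le> - norm w\<close> at \<open>-w\<close>.
\<close>

lemma dual_space_separates_points:
  fixes x z :: "'a::real_normed_vector"
  assumes "\<And>\<zeta> :: 'a \<Rightarrow>\<^sub>L real. \<zeta> x = \<zeta> z"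
  shows "x = z"
proof -
  have nrm: "sublinear (norm :: 'a \<Rightarrow> real)" by (simp add: sublinear_def norm_triangle_ineq)
  define w where "w = x - z"
  let ?p = "directional_reduction norm w"
  obtain q where q: "sublinear q" "q \<le> ?p" "\<And>q'. sublinear q' \<Longrightarrow> q' \<le> q \<Longrightarrow> q' = q"
    using minimal_sublinear_exists[OF sublinear_directional_reduction[OF nrm]] by blast
  have lin: "linear q" using minimal_sublinear_linear[OF q(1)] q(3) by blast
  have q_le: "q u \<le> norm u" for u
    using le_funD[OF q(2), of u] directional_reduction_le[OF nrm, of 0 w u] by simp
  have "norm (q u) \<le> norm u * 1" for u
    using q_le[of u] q_le[of "-u"] linear_neg[OF lin, of u] by (simp add: abs_le_iff)
  then have "bounded_linear q"
    using lin by (intro bounded_linear_intro[where K = 1]) (auto simp: linear_add linear_cmul)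
  then have "q x = q z" using assms[of "Blinfun q"] by (simp add: bounded_linear_Blinfun_apply)
  then have "q (- w) = 0" unfolding w_def by (simp add: linear_diff[OF lin])
  moreover have "q (- w) \<le> - norm w"
    using le_funD[OF q(2), of "-w"] directional_reduction_le[OF nrm, of 1 w "-w"] by simp
  ultimately show ?thesis by (simp add: w_def)
qed

section \<open>Minimization of strongly convex functionals\<close>

text \<open>
  The real-valued form of a proper, lower semicontinuous, strongly convex functional, with its
  effective domain \<open>D\<close> made explicit. The assumption \<open>lsc\<close> expresses lower semicontinuity of the
  functional extended by \<open>\<infinity>\<close>: besides the inequality, it says that limits of points with bounded
  values stay in \<open>D\<close>.
\<close>

locale strongly_convex_functional =
  fixes D :: "'a::banach set" and f :: "'a \<Rightarrow> real" and c :: real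
  assumes nonempty: "D \<noteq> {}"
    and c_pos: "c > 0"
    and convex_dom: "x \<in> D \<Longrightarrow> z \<in> D \<Longrightarrow> 0 \<le> \<gamma> \<Longrightarrow> \<gamma> \<le> 1 \<Longrightarrow> \<gamma> *\<^sub>R x + (1 - \<gamma>) *\<^sub>R z \<in> D"
    and strong: "x \<in> D \<Longrightarrow> z \<in> D \<Longrightarrow> 0 \<le> \<gamma> \<Longrightarrow> \<gamma> \<le> 1 \<Longrightarrow>
      f (\<gamma> *\<^sub>R x + (1 - \<gamma>) *\<^sub>R z) + c * \<gamma> * (1 - \<gamma>) * (norm (x - z))\<^sup>2 \<le> \<gamma> * f x + (1 - \<gamma>) * f z"
    and lsc: "(\<And>n::nat. X n \<in> D) \<Longrightarrow> X \<longlonglongrightarrow> l \<Longrightarrow> (\<And>n. f (X n) \<le> b n) \<Longrightarrow> b \<longlonglongrightarrow> m \<Longrightarrow> l \<in> D \<and> f l \<le> m"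
begin

lemma locally_bounded_below:
  assumes z: "z \<in> D"
  obtains r where "r > 0" "\<And>u. u \<in> D \<Longrightarrow> norm (u - z) < r \<Longrightarrow> f z - 1 \<le> f u"
proof -
  have "\<exists>r>0. \<forall>u\<in>D. norm (u - z) < r \<longrightarrow> f z - 1 \<le> f u"
  proof (rule ccontr)
    assume "\<not> ?thesis"
    then have no: "\<exists>u\<in>D. norm (u - z) < r \<and> f u < f z - 1" if "r > 0" for r
      using that by (meson not_le)
    have "\<exists>u\<in>D. norm (u - z) < 1 / real (Suc n) \<and> f u < f z - 1" for n
      by (rule no) simp
    then obtain X where X: "\<And>n. X n \<in> D" "\<And>n. norm (X n - z) < 1 / real (Suc n)"
        "\<And>n. f (X n) < f z - 1" by metis
    have "(\<lambda>n. X n - z) \<longlonglongrightarrow> 0"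
    proof (rule Lim_null_comparison)
      show "\<forall>\<^sub>F n in sequentially. norm (X n - z) \<le> 1 / real (Suc n)"
        using X(2) by (intro always_eventually allI less_imp_le)
      show "(\<lambda>n. 1 / real (Suc n)) \<longlonglongrightarrow> 0" by (rule LIMSEQ_Suc[OF lim_inverse_n'])
    qed
    then have "X \<longlonglongrightarrow> z" by (simp add: LIM_zero_iff)
    then have "z \<in> D \<and> f z \<le> f z - 1"
      using X(1,3) by (intro lsc[of X z "\<lambda>_. f z - 1"] less_imp_le tendsto_const)
    then show False by simp
  qed
  then show ?thesis using that by blast
qed

text \<open>
  Near a point \<open>z\<close> of the domain lower semicontinuity gives the bound \<open>f z - 1\<close>. A point \<open>u\<close> far away
  is compared with the point at distance \<open>s\<close> from \<open>z\<close> on the segment from \<open>z\<close> to \<open>u\<close>; strong convexity turns the bound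
  there into one for \<open>f u\<close> that is quadratic in the distance with positive leading coefficient, hence
  bounded below.
\<close>

lemma bounded_below: "\<exists>B. \<forall>u\<in>D. B \<le> f u"
proof -
  obtain z where z: "z \<in> D" using nonempty by blast
  obtain r where r: "r > 0" "\<And>u. u \<in> D \<Longrightarrow> norm (u - z) < r \<Longrightarrow> f z - 1 \<le> f u"
    using locally_bounded_below[OF z] by blast
  define s where "s = r / 2"
  have s: "s > 0" "s < r" using r(1) by (auto simp: s_def)
  have far: "f z - d / s + c * d * (d - s) \<le> f u"
    if u: "u \<in> D" and d: "d = norm (u - z)" "s \<le> d" for u d
  proof -
    define \<gamma> where "\<gamma> = s / d"
    have dpos: "d > 0" using s(1) d(2) by linarith
    have \<gamma>: "0 < \<gamma>" "\<gamma> \<le> 1" "\<gamma> * d = s" using s d(2) dpos by (auto simp: \<gamma>_def)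
    let ?w = "\<gamma> *\<^sub>R u + (1 - \<gamma>) *\<^sub>R z"
    have "?w - z = \<gamma> *\<^sub>R (u - z)" by (simp add: algebra_simps)
    then have "norm (?w - z) = s" using \<gamma> d by simp
    then have "f z - 1 \<le> f ?w" using s \<gamma> by (intro r(2) convex_dom u z) auto
    with strong[OF u z, of \<gamma>] \<gamma> d
    have "f z - 1 + c * \<gamma> * (1 - \<gamma>) * d\<^sup>2 \<le> \<gamma> * f u + (1 - \<gamma>) * f z" by simp
    moreover have "c * \<gamma> * (1 - \<gamma>) * d\<^sup>2 = \<gamma> * (c * d * (d - \<gamma> * d))"
      by (simp add: algebra_simps power2_eq_square)
    ultimately have "f z - 1 + \<gamma> * (c * d * (d - s)) \<le> \<gamma> * f u + (1 - \<gamma>) * f z"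
      by (simp only: \<gamma>(3))
    then have "\<gamma> * (f z + c * d * (d - s)) - 1 \<le> \<gamma> * f u"
      unfolding distrib_left left_diff_distrib by simp
    then have "f z + c * d * (d - s) - 1 / \<gamma> \<le> f u" using \<gamma> by (simp add: field_simps)
    then show ?thesis using s dpos by (simp add: \<gamma>_def)
  qed
  \<comment> \<open>The subtracted fraction is the minimum over d of c d (d - s) - d / s with reversed sign.\<close>
  define B where "B = f z - 1 - (1 / s + c * s)\<^sup>2 / (4 * c)"
  have "B \<le> f u" if u: "u \<in> D" for u
  proof (cases "norm (u - z) < r")
    case True
    have "0 \<le> (1 / s + c * s)\<^sup>2 / (4 * c)" using c_pos by simp
    then show ?thesis using r(2)[OF u True] by (simp add: B_def)
  next
    case False
    define d where "d = norm (u - z)"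
    have "0 \<le> c * (d - (1 / s + c * s) / (2 * c))\<^sup>2" using c_pos by simp
    also have "\<dots> = c * d * (d - s) - d / s + (1 / s + c * s)\<^sup>2 / (4 * c)"
      using c_pos s by (simp add: field_simps power2_eq_square)
    finally have "- (1 / s + c * s)\<^sup>2 / (4 * c) \<le> c * d * (d - s) - d / s" by simp
    then show ?thesis using far[OF u d_def] False s by (simp add: B_def d_def)
  qed
  then show ?thesis by blast
qed

text \<open>
  Strong convexity on the segment from the minimizer \<open>x\<close> to \<open>z\<close>, divided by \<open>\<gamma>\<close>, in the limit \<open>\<gamma> \<rightarrow> 0\<close>.
\<close>

lemma quadratic_growth:
  assumes x: "x \<in> D" and min: "\<And>z. z \<in> D \<Longrightarrow> f x \<le> f z" and z: "z \<in> D"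
  shows "f x + c * (norm (z - x))\<^sup>2 \<le> f z"
proof -
  have ev: "c * (1 - \<gamma>) * (norm (z - x))\<^sup>2 \<le> f z - f x" if \<gamma>: "0 < \<gamma>" "\<gamma> < 1" for \<gamma>
  proof -
    have "f x \<le> f (\<gamma> *\<^sub>R z + (1 - \<gamma>) *\<^sub>R x)" using \<gamma> by (intro min convex_dom x z) auto
    with strong[OF z x, of \<gamma>] \<gamma>
    have "\<gamma> * (c * (1 - \<gamma>) * (norm (z - x))\<^sup>2) \<le> \<gamma> * (f z - f x)"
      by (simp add: algebra_simps)
    then show ?thesis using \<gamma> by simp
  qed
  have "((\<lambda>\<gamma>. c * (1 - \<gamma>) * (norm (z - x))\<^sup>2) \<longlongrightarrow> c * (1 - 0) * (norm (z - x))\<^sup>2) (at_right 0)"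
    by (intro tendsto_intros)
  moreover have "eventually (\<lambda>\<gamma>. c * (1 - \<gamma>) * (norm (z - x))\<^sup>2 \<le> f z - f x) (at_right 0)"
    using eventually_at_right_real[of 0 1] by (rule eventually_mono) (auto intro: ev)
  ultimately have "c * (1 - 0) * (norm (z - x))\<^sup>2 \<le> f z - f x"
    by (rule tendsto_upperbound) simp
  then show ?thesis by simp
qed

text \<open>
  A minimizing sequence is Cauchy by strong convexity at midpoints, and lower semicontinuity makes its
  limit a minimizer.
\<close>

lemma minimizer_exists:
  obtains x where "x \<in> D" "\<And>z. z \<in> D \<Longrightarrow> f x + c * (norm (z - x))\<^sup>2 \<le> f z"
proof -
  obtain B where B: "\<And>u. u \<in> D \<Longrightarrow> B \<le> f u" using bounded_below by blast
  define m where "m = (INF u\<in>D. f u)"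
  have bdd: "bdd_below (f ` D)" using B by (intro bdd_belowI2) auto
  have m_le: "m \<le> f u" if "u \<in> D" for u unfolding m_def by (rule cINF_lower[OF bdd that])
  have "\<exists>u\<in>D. f u < m + 1 / real (Suc n)" for n
    using cINF_less_iff[OF nonempty bdd, of "m + 1 / real (Suc n)"] by (simp add: m_def)
  then obtain X where X: "\<And>n. X n \<in> D" "\<And>n. f (X n) < m + 1 / real (Suc n)" by metis
  have mid: "c * (norm (X i - X j))\<^sup>2 \<le> 2 / real (Suc i) + 2 / real (Suc j)" for i j
  proof -
    have "m \<le> f ((1/2) *\<^sub>R X i + (1 - 1/2) *\<^sub>R X j)"
      using convex_dom[OF X(1) X(1), of "1/2"] by (intro m_le) simp
    with strong[OF X(1)[of i] X(1)[of j], of "1/2"]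
    have "m + c * (norm (X i - X j))\<^sup>2 / 4 \<le> f (X i) / 2 + f (X j) / 2" by simp
    with X(2)[of i] X(2)[of j] show ?thesis by simp
  qed
  have "Cauchy X"
  proof (rule metric_CauchyI)
    fix e :: real assume e: "e > 0"
    obtain N where N: "4 / (c * e\<^sup>2) < real N" using reals_Archimedean2 by blast
    have "dist (X i) (X j) < e" if ij: "i \<ge> N" "j \<ge> N" for i j
    proof -
      have pos: "0 < c * e\<^sup>2" using e c_pos by simp
      have N0: "0 < real N" using N pos by (meson divide_pos_pos less_trans zero_less_numeral)
      have "2 / real (Suc i) \<le> 2 / real N" "2 / real (Suc j) \<le> 2 / real N"
        using ij N0 by (auto intro!: divide_left_mono mult_pos_pos)
      with mid[of i j] have "c * (norm (X i - X j))\<^sup>2 \<le> 4 / real N" by simp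
      also have "\<dots> < c * e\<^sup>2" using N N0 pos by (simp add: field_simps)
      finally have "(norm (X i - X j))\<^sup>2 < e\<^sup>2" using c_pos by simp
      then show ?thesis using e by (simp add: dist_norm power2_less_imp_less)
    qed
    then show "\<exists>M. \<forall>i\<ge>M. \<forall>j\<ge>M. dist (X i) (X j) < e" by blast
  qed
  then obtain x where x: "X \<longlonglongrightarrow> x" using Cauchy_convergent_iff convergent_def by blast
  have "(\<lambda>n. m + 1 / real (Suc n)) \<longlonglongrightarrow> m + 0"
    by (intro tendsto_intros LIMSEQ_Suc[OF lim_inverse_n'])
  then have "x \<in> D \<and> f x \<le> m"
    using lsc[OF X(1) x, of "\<lambda>n. m + 1 / real (Suc n)" m] X(2) by (auto intro: less_imp_le)
  then have xD: "x \<in> D" and "\<And>z. z \<in> D \<Longrightarrow> f x \<le> f z" using m_le by (auto intro: order_trans)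
  then have "\<And>z. z \<in> D \<Longrightarrow> f x + c * (norm (z - x))\<^sup>2 \<le> f z" using quadratic_growth by blast
  then show ?thesis using that xD by blast
qed

section \<open>Smoothness of the conjugate\<close>

lemma add_continuous_convex:
  assumes cont: "continuous_on UNIV g"
    and conv: "\<And>x z \<gamma>. 0 \<le> \<gamma> \<Longrightarrow> \<gamma> \<le> 1 \<Longrightarrow> g (\<gamma> *\<^sub>R x + (1 - \<gamma>) *\<^sub>R z) \<le> \<gamma> * g x + (1 - \<gamma>) * g z"
  shows "strongly_convex_functional D (\<lambda>z. f z + g z) c"
proof (unfold_locales, goal_cases)
  case 1 show ?case by (rule nonempty)
next
  case 2 show ?case by (rule c_pos)
next
  case (3 x z \<gamma>) then show ?case by (rule convex_dom)
next
  case (4 x z \<gamma>)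
  show ?case unfolding distrib_left using strong[OF 4] conv[OF 4(3,4), of x z] by linarith
next
  case (5 X l b m)
  have "(\<lambda>n. g (X n)) \<longlonglongrightarrow> g l"
    by (rule isCont_tendsto_compose[OF _ 5(2)]) (use cont in \<open>simp add: continuous_on_eq_continuous_at\<close>)
  then have lim: "(\<lambda>n. b n - g (X n)) \<longlonglongrightarrow> m - g l" using 5(4) by (intro tendsto_intros)
  have "f (X n) \<le> b n - g (X n)" for n using 5(3)[of n] by linarith
  then have "l \<in> D \<and> f l \<le> m - g l" by (rule lsc[OF 5(1,2) _ lim])
  then show ?case by simp
qed

text \<open>
  Tilting by a continuous linear functional keeps strong convexity, so \<open>f - \<xi>\<close> has a minimizer. This
  one inequality contains \<open>\<xi> \<in> \<partial>f x\<close>, the attainment of the conjugate at \<open>x\<close>, and the lower bound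
  for the Bregman distance.
\<close>

lemma dual_point_exists:
  fixes \<xi> :: "'a \<Rightarrow>\<^sub>L real"
  shows "\<exists>x\<in>D. \<forall>z\<in>D. f x + \<xi> (z - x) + c * (norm (z - x))\<^sup>2 \<le> f z"
proof -
  interpret tilted: strongly_convex_functional D "\<lambda>z. f z + - \<xi> z" c
    by (rule add_continuous_convex)
      (auto intro!: continuous_intros simp: blinfun.add_right blinfun.scaleR_right)
  obtain x where "x \<in> D" "\<And>z. z \<in> D \<Longrightarrow> f x + - \<xi> x + c * (norm (z - x))\<^sup>2 \<le> f z + - \<xi> z"
    using tilted.minimizer_exists by blast
  then show ?thesis by (intro bexI[of _ x]) (auto simp: blinfun.diff_right algebra_simps)
qed

definition dual_point :: "('a \<Rightarrow>\<^sub>L real) \<Rightarrow> 'a" where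
  "dual_point \<xi> = (SOME x. x \<in> D \<and> (\<forall>z\<in>D. f x + \<xi> (z - x) + c * (norm (z - x))\<^sup>2 \<le> f z))"

definition real_conjugate :: "('a \<Rightarrow>\<^sub>L real) \<Rightarrow> real" where
  "real_conjugate \<xi> = \<xi> (dual_point \<xi>) - f (dual_point \<xi>)"

lemma dual_point:
  fixes \<xi> :: "'a \<Rightarrow>\<^sub>L real"
  shows "dual_point \<xi> \<in> D"
    and "z \<in> D \<Longrightarrow> f (dual_point \<xi>) + \<xi> (z - dual_point \<xi>) + c * (norm (z - dual_point \<xi>))\<^sup>2 \<le> f z"
  using someI_ex[OF dual_point_exists[of \<xi>, unfolded Bex_def]] unfolding dual_point_def by auto

lemma fenchel_young:
  fixes \<xi> :: "'a \<Rightarrow>\<^sub>L real"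
  shows "z \<in> D \<Longrightarrow> \<xi> z - f z \<le> real_conjugate \<xi>"
proof -
  assume z: "z \<in> D"
  have "0 \<le> c * (norm (z - dual_point \<xi>))\<^sup>2" using c_pos by simp
  then show ?thesis using dual_point(2)[OF z, of \<xi>]
    by (simp add: real_conjugate_def blinfun.diff_right)
qed

text \<open>
  The equality case of Fenchel-Young: any point at which \<open>\<xi>\<close> is a subgradient computes the conjugate.
\<close>

lemma real_conjugate_eq:
  fixes \<xi> :: "'a \<Rightarrow>\<^sub>L real"
  assumes "x \<in> D" "\<And>z. z \<in> D \<Longrightarrow> f x + \<xi> (z - x) \<le> f z"
  shows "real_conjugate \<xi> = \<xi> x - f x"
  using fenchel_young[OF assms(1), of \<xi>] assms(2)[OF dual_point(1), of \<xi>]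
  by (simp add: real_conjugate_def blinfun.diff_right)

lemma real_conjugate_subgradient:
  fixes \<xi> \<zeta> :: "'a \<Rightarrow>\<^sub>L real"
  shows "real_conjugate \<xi> + (\<zeta> - \<xi>) (dual_point \<xi>) \<le> real_conjugate \<zeta>"
  using fenchel_young[OF dual_point(1)[of \<xi>], of \<zeta>]
  by (simp add: real_conjugate_def blinfun.diff_left)

text \<open>
  The strong convexity constant of \<open>f\<close> becomes a smoothness constant of its conjugate: the quadratic
  term in the growth at \<open>dual_point \<xi>\<close> absorbs the cross term \<open>norm (\<zeta> - \<xi>) * norm (z - x)\<close>, up to
  \<open>norm (\<zeta> - \<xi>)\<^sup>2 / (4 * c)\<close>.
\<close>

lemma real_conjugate_quadratic_upper_bound:
  fixes \<xi> \<zeta> :: "'a \<Rightarrow>\<^sub>L real"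
  shows "real_conjugate \<zeta> \<le> real_conjugate \<xi> + (\<zeta> - \<xi>) (dual_point \<xi>) + (norm (\<zeta> - \<xi>))\<^sup>2 / (4 * c)"
proof -
  define z where "z = dual_point \<zeta>"
  define x where "x = dual_point \<xi>"
  define a where "a = norm (\<zeta> - \<xi>)"
  define d where "d = norm (z - x)"
  have "(\<zeta> - \<xi>) (z - x) \<le> a * d"
    using norm_blinfun[of "\<zeta> - \<xi>" "z - x"] by (simp add: a_def d_def)
  moreover have "0 \<le> c * (d - a / (2 * c))\<^sup>2" using c_pos by simp
  moreover have "c * (d - a / (2 * c))\<^sup>2 = c * d\<^sup>2 - a * d + a\<^sup>2 / (4 * c)"
    using c_pos by (simp add: field_simps power2_eq_square)
  moreover have "f x + \<xi> (z - x) + c * d\<^sup>2 \<le> f z"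
    unfolding x_def d_def by (intro dual_point) (simp add: z_def dual_point)
  ultimately show ?thesis
    unfolding real_conjugate_def z_def[symmetric] x_def[symmetric] a_def[symmetric]
    by (simp add: blinfun.diff_left blinfun.diff_right)
qed

lemma real_conjugate_has_derivative:
  "(real_conjugate has_derivative (\<lambda>\<zeta>. \<zeta> (dual_point \<xi>))) (at \<xi>)"
proof (rule has_derivativeI)
  show "bounded_linear (\<lambda>\<zeta>. blinfun_apply \<zeta> (dual_point \<xi>))"
    by (rule blinfun.bounded_linear_left)
  let ?rem = "\<lambda>\<zeta> :: 'a \<Rightarrow>\<^sub>L real. (real_conjugate \<zeta> - real_conjugate \<xi> - (\<zeta> - \<xi>) (dual_point \<xi>)) /\<^sub>R norm (\<zeta> - \<xi>)"
  have "norm (?rem \<zeta>) \<le> norm (\<zeta> - \<xi>) / (4 * c)" for \<zeta>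
  proof -
    have "\<bar>real_conjugate \<zeta> - real_conjugate \<xi> - (\<zeta> - \<xi>) (dual_point \<xi>)\<bar> \<le> (norm (\<zeta> - \<xi>))\<^sup>2 / (4 * c)"
      using real_conjugate_quadratic_upper_bound[of \<zeta> \<xi>] real_conjugate_subgradient[of \<xi> \<zeta>] by simp
    then show ?thesis
      using c_pos by (cases "\<zeta> = \<xi>") (auto simp: field_simps power2_eq_square abs_mult)
  qed
  moreover have "((\<lambda>\<zeta>. norm (\<zeta> - \<xi>) / (4 * c)) \<longlongrightarrow> norm (\<xi> - \<xi>) / (4 * c)) (at \<xi>)"
    using c_pos by (intro tendsto_intros) auto
  ultimately show "(?rem \<longlongrightarrow> 0) (at \<xi>)"
    by (intro Lim_null_comparison[of ?rem "\<lambda>\<zeta>. norm (\<zeta> - \<xi>) / (4 * c)"]) (auto intro: always_eventually)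
qed

lemma derivative_representer_unique:
  assumes "(real_conjugate has_derivative (\<lambda>\<zeta>. \<zeta> x)) (at \<xi>)"
  shows "x = dual_point \<xi>"
  by (rule dual_space_separates_points)
    (rule fun_cong[OF has_derivative_unique[OF assms real_conjugate_has_derivative]])

lemma bregman_lower_bound:
  fixes \<xi> :: "'a \<Rightarrow>\<^sub>L real"
  assumes z: "z \<in> D"
  shows "c * (norm (z - dual_point \<xi>))\<^sup>2 \<le> f z + real_conjugate \<xi> - \<xi> z"
  using dual_point(2)[OF z, of \<xi>] by (simp add: real_conjugate_def blinfun.diff_right)

section \<open>Strong duality by quadratic penalties\<close>

text \<open>
  The quadratic penalty of the constraint \<open>A z = y\<close>. Its minimizers approach the constrained problem,
  and their optimality conditions supply the multipliers in the strong duality theorem below.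
\<close>

definition penalized :: "('a \<Rightarrow>\<^sub>L 'b::real_inner) \<Rightarrow> 'b \<Rightarrow> real \<Rightarrow> 'a \<Rightarrow> real" where
  "penalized A y k z = f z + k * (norm (A z - y))\<^sup>2"

lemma penalized_strongly_convex:
  assumes k: "k \<ge> 0"
  shows "strongly_convex_functional D (penalized A y k) c"
  unfolding penalized_def
proof (rule add_continuous_convex)
  show "continuous_on UNIV (\<lambda>z. k * (norm (A z - y))\<^sup>2)" by (intro continuous_intros)
  fix x z :: 'a and \<gamma> :: real assume \<gamma>: "0 \<le> \<gamma>" "\<gamma> \<le> 1"
  have "A (\<gamma> *\<^sub>R x + (1 - \<gamma>) *\<^sub>R z) - y = \<gamma> *\<^sub>R (A x - y) + (1 - \<gamma>) *\<^sub>R (A z - y)"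
    by (simp add: blinfun.bilinear_simps algebra_simps)
  then have "norm (A (\<gamma> *\<^sub>R x + (1 - \<gamma>) *\<^sub>R z) - y) \<le> \<gamma> * norm (A x - y) + (1 - \<gamma>) * norm (A z - y)"
    using \<gamma> norm_triangle_ineq[of "\<gamma> *\<^sub>R (A x - y)" "(1 - \<gamma>) *\<^sub>R (A z - y)"] by simp
  then have "(norm (A (\<gamma> *\<^sub>R x + (1 - \<gamma>) *\<^sub>R z) - y))\<^sup>2
      \<le> (\<gamma> * norm (A x - y) + (1 - \<gamma>) * norm (A z - y))\<^sup>2"
    by (intro power_mono) auto
  also have "\<dots> \<le> \<gamma> * (norm (A x - y))\<^sup>2 + (1 - \<gamma>) * (norm (A z - y))\<^sup>2"
  proof -
    have "0 \<le> \<gamma> * (1 - \<gamma>) * (norm (A x - y) - norm (A z - y))\<^sup>2" using \<gamma> by simp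
    then show ?thesis by (simp add: power2_eq_square algebra_simps)
  qed
  finally have "k * (norm (A (\<gamma> *\<^sub>R x + (1 - \<gamma>) *\<^sub>R z) - y))\<^sup>2
      \<le> k * (\<gamma> * (norm (A x - y))\<^sup>2 + (1 - \<gamma>) * (norm (A z - y))\<^sup>2)"
    using k by (rule mult_left_mono)
  then show "k * (norm (A (\<gamma> *\<^sub>R x + (1 - \<gamma>) *\<^sub>R z) - y))\<^sup>2
      \<le> \<gamma> * (k * (norm (A x - y))\<^sup>2) + (1 - \<gamma>) * (k * (norm (A z - y))\<^sup>2)"
    by (simp add: algebra_simps)
qed

text \<open>
  The derivative of the penalty at the minimizer \<open>u\<close> must be balanced by a subgradient of \<open>f\<close>. It is
  obtained by comparing \<open>u\<close> with the points \<open>\<gamma> *\<^sub>R z + (1 - \<gamma>) *\<^sub>R u\<close>, dividing by \<open>\<gamma>\<close> and letting \<open>\<gamma> \<rightarrow> 0\<close>.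
\<close>

lemma penalized_minimizer_subgradient:
  fixes A :: "'a \<Rightarrow>\<^sub>L 'b::real_inner"
  assumes u: "u \<in> D" and min: "\<And>w. w \<in> D \<Longrightarrow> penalized A y k u \<le> penalized A y k w"
    and z: "z \<in> D"
  shows "f u + dual_adjoint A ((- 2 * k) *\<^sub>R (A u - y)) (z - u) \<le> f z"
proof -
  define e where "e = A u - y"
  have *: "0 \<le> f z - f u + 2 * k * inner e (A (z - u)) + k * \<gamma> * (norm (A (z - u)))\<^sup>2"
    if \<gamma>: "0 < \<gamma>" "\<gamma> < 1" for \<gamma>
  proof -
    let ?w = "\<gamma> *\<^sub>R z + (1 - \<gamma>) *\<^sub>R u"
    have wD: "?w \<in> D" using \<gamma> by (intro convex_dom z u) auto
    have Aw: "A ?w - y = e + \<gamma> *\<^sub>R A (z - u)"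
      by (simp add: e_def blinfun.bilinear_simps algebra_simps)
    have "f u + k * (norm e)\<^sup>2 \<le> penalized A y k ?w"
      using min[OF wD] by (simp add: penalized_def e_def)
    also have "\<dots> \<le> \<gamma> * f z + (1 - \<gamma>) * f u + k * (norm (A ?w - y))\<^sup>2"
    proof -
      have "0 \<le> c * \<gamma> * (1 - \<gamma>) * (norm (z - u))\<^sup>2" using c_pos \<gamma> by simp
      then show ?thesis
        using strong[OF z u, of \<gamma>] \<gamma> by (simp add: penalized_def)
    qed
    also have "(norm (A ?w - y))\<^sup>2
        = (norm e)\<^sup>2 + 2 * \<gamma> * inner e (A (z - u)) + \<gamma>\<^sup>2 * (norm (A (z - u)))\<^sup>2"
      unfolding Aw power2_norm_eq_inner
      by (simp add: inner_add_left inner_add_right inner_commute power2_eq_square)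
    finally have "0 \<le> \<gamma> * (f z - f u + 2 * k * inner e (A (z - u)) + k * \<gamma> * (norm (A (z - u)))\<^sup>2)"
      by (simp add: algebra_simps power2_eq_square)
    then show ?thesis using \<gamma> by (simp add: zero_le_mult_iff)
  qed
  have "((\<lambda>\<gamma>. f z - f u + 2 * k * inner e (A (z - u)) + k * \<gamma> * (norm (A (z - u)))\<^sup>2)
      \<longlongrightarrow> f z - f u + 2 * k * inner e (A (z - u)) + k * 0 * (norm (A (z - u)))\<^sup>2) (at_right 0)"
    by (intro tendsto_intros)
  moreover have "eventually (\<lambda>\<gamma>. 0 \<le> f z - f u + 2 * k * inner e (A (z - u)) + k * \<gamma> * (norm (A (z - u)))\<^sup>2) (at_right 0)"
    using eventually_at_right_real[of 0 1] by (rule eventually_mono) (auto intro: *)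
  ultimately have "0 \<le> f z - f u + 2 * k * inner e (A (z - u)) + k * 0 * (norm (A (z - u)))\<^sup>2"
    by (rule tendsto_lowerbound) simp
  then show ?thesis by (simp add: dual_adjoint_def e_def)
qed

text \<open>
  The minimal values of the penalized functionals increase with \<open>n\<close> and stay below \<open>f xdag\<close>. By
  quadratic growth their increments control the distances of the minimizers, which are thus a Cauchy
  sequence. The limit satisfies the constraint, since the penalty stays bounded while its weight grows;
  so values \<open>\<le> f xdag - \<epsilon>\<close> all along the sequence would contradict the minimality of \<open>xdag\<close>.
\<close>

lemma penalized_minimizers_approach:
  fixes A :: "'a \<Rightarrow>\<^sub>L 'b::real_inner"
  assumes xdag: "xdag \<in> D" "A xdag = y" and min: "\<And>z. z \<in> D \<Longrightarrow> A z = y \<Longrightarrow> f xdag \<le> f z"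
    and \<epsilon>: "\<epsilon> > 0"
  obtains u and n :: nat where "u \<in> D" "\<And>w. w \<in> D \<Longrightarrow> penalized A y n u \<le> penalized A y n w"
    "f xdag - \<epsilon> < f u"
proof -
  have "\<forall>n::nat. \<exists>x\<in>D. \<forall>z\<in>D. penalized A y n x + c * (norm (z - x))\<^sup>2 \<le> penalized A y n z"
  proof
    fix n :: nat
    have "strongly_convex_functional D (penalized A y (real n)) c"
      by (rule penalized_strongly_convex) simp
    then obtain x where "x \<in> D"
      "\<And>z. z \<in> D \<Longrightarrow> penalized A y n x + c * (norm (z - x))\<^sup>2 \<le> penalized A y n z"
      using strongly_convex_functional.minimizer_exists by blast
    then show "\<exists>x\<in>D. \<forall>z\<in>D. penalized A y n x + c * (norm (z - x))\<^sup>2 \<le> penalized A y n z"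
      by (intro bexI[of _ x] ballI)
  qed
  then obtain X where "\<forall>n. X n \<in> D \<and> (\<forall>z\<in>D.
      penalized A y (real n) (X n) + c * (norm (z - X n))\<^sup>2 \<le> penalized A y (real n) z)"
    unfolding Bex_def by (rule choice[THEN exE])
  then have X: "\<And>n::nat. X n \<in> D"
      "\<And>n z. z \<in> D \<Longrightarrow> penalized A y (real n) (X n) + c * (norm (z - X n))\<^sup>2 \<le> penalized A y (real n) z"
    by blast+
  have nonneg: "0 \<le> c * (norm u)\<^sup>2" for u :: 'a using c_pos by simp
  have value_le: "penalized A y n (X n) \<le> f xdag" for n
    using X(2)[OF xdag(1), of n] nonneg[of "xdag - X n"] by (simp add: penalized_def xdag(2))
  have f_le: "f (X n) \<le> f xdag" for n
  proof -
    have "f (X n) \<le> penalized A y n (X n)" by (simp add: penalized_def)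
    then show ?thesis using value_le by (rule order_trans)
  qed
  have step: "penalized A y i (X i) + c * (norm (X j - X i))\<^sup>2 \<le> penalized A y j (X j)" if "i \<le> j" for i j
  proof -
    have "penalized A y i (X j) \<le> penalized A y j (X j)" using that by (simp add: penalized_def mult_right_mono)
    then show ?thesis using X(2)[OF X(1), of i j] by simp
  qed
  have "incseq (\<lambda>n. penalized A y n (X n))"
  proof (rule incseq_SucI)
    fix n show "penalized A y n (X n) \<le> penalized A y (Suc n) (X (Suc n))"
      using step[of n "Suc n"] nonneg[of "X (Suc n) - X n"] by simp
  qed
  then obtain m where "(\<lambda>n. penalized A y n (X n)) \<longlonglongrightarrow> m"
    by (rule incseq_convergent[where B = "f xdag"]) (use value_le in blast)+
  then have Cau: "Cauchy (\<lambda>n. penalized A y n (X n))" by (rule LIMSEQ_imp_Cauchy)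
  have "Cauchy X"
  proof (rule metric_CauchyI)
    fix e :: real assume e: "e > 0"
    then have "0 < c * e\<^sup>2" using c_pos by simp
    then obtain N where N: "\<And>i j. i \<ge> N \<Longrightarrow> j \<ge> N \<Longrightarrow> \<bar>penalized A y i (X i) - penalized A y j (X j)\<bar> < c * e\<^sup>2"
      using metric_CauchyD[OF Cau, of "c * e\<^sup>2"] unfolding dist_real_def by blast
    have le: "dist (X i) (X j) < e" if ij: "i \<ge> N" "i \<le> j" for i j
    proof -
      have "\<bar>penalized A y i (X i) - penalized A y j (X j)\<bar> < c * e\<^sup>2" using ij by (intro N) auto
      then have "c * (norm (X j - X i))\<^sup>2 < c * e\<^sup>2" using step[OF ij(2)] by linarith
      then have "(norm (X j - X i))\<^sup>2 < e\<^sup>2" using c_pos by simp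
      then show ?thesis using e by (simp add: dist_norm norm_minus_commute power2_less_imp_less)
    qed
    have "dist (X i) (X j) < e" if "i \<ge> N" "j \<ge> N" for i j
      using le[OF that(1)] le[OF that(2)] by (metis dist_commute linear)
    then show "\<exists>M. \<forall>i\<ge>M. \<forall>j\<ge>M. dist (X i) (X j) < e" by blast
  qed
  then obtain x where x: "X \<longlonglongrightarrow> x" using Cauchy_convergent_iff convergent_def by blast
  obtain B where B: "\<And>u. u \<in> D \<Longrightarrow> B \<le> f u" using bounded_below by blast
  have "A x = y"
  proof -
    have "(\<lambda>n. (norm (A (X n) - y))\<^sup>2) \<longlonglongrightarrow> (norm (A x - y))\<^sup>2" by (intro tendsto_intros x)
    then have l1: "(\<lambda>n. (norm (A (X (Suc n)) - y))\<^sup>2) \<longlonglongrightarrow> (norm (A x - y))\<^sup>2" by (rule LIMSEQ_Suc)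
    have l2: "(\<lambda>n. (f xdag - B) * (1 / real (Suc n))) \<longlonglongrightarrow> (f xdag - B) * 0"
      by (intro tendsto_intros LIMSEQ_Suc[OF lim_inverse_n'])
    have "(norm (A (X (Suc n)) - y))\<^sup>2 \<le> (f xdag - B) * (1 / real (Suc n))" for n
    proof -
      have "real (Suc n) * (norm (A (X (Suc n)) - y))\<^sup>2 \<le> f xdag - B"
        using value_le[of "Suc n"] B[OF X(1), of "Suc n"] by (simp add: penalized_def)
      then show ?thesis by (simp add: field_simps)
    qed
    then have "(norm (A x - y))\<^sup>2 \<le> (f xdag - B) * 0"
      using LIMSEQ_le[OF l1 l2] by blast
    then show ?thesis by simp
  qed
  have "\<exists>n. f xdag - \<epsilon> < f (X n)"
  proof (rule ccontr)
    assume "\<nexists>n. f xdag - \<epsilon> < f (X n)"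
    then have "x \<in> D \<and> f x \<le> f xdag - \<epsilon>"
      by (intro lsc[OF X(1) x, of "\<lambda>_. f xdag - \<epsilon>"]) (auto simp: not_less)
    with min[of x] \<open>A x = y\<close> \<epsilon> show False by auto
  qed
  then obtain n where n: "f xdag - \<epsilon> < f (X n)" by blast
  have "penalized A y n (X n) \<le> penalized A y n w" if "w \<in> D" for w
    using X(2)[OF that, of n] nonneg[of "w - X n"] by linarith
  then show ?thesis using that X(1) n by blast
qed

text \<open>
  The functional whose gradient flow with \<open>w = v\<close> is the dual gradient flow for data \<open>v\<close>; its negative
  is the dual functional of minimizing \<open>f\<close> subject to \<open>A z = w\<close>.
\<close>

definition dual_objective :: "('a \<Rightarrow>\<^sub>L 'b::real_inner) \<Rightarrow> 'b \<Rightarrow> 'b \<Rightarrow> real" where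
  "dual_objective A w \<mu> = real_conjugate (dual_adjoint A \<mu>) - inner \<mu> w"

text \<open>
  There is no duality gap, although the supremum of the dual problem need not be attained: the
  multiplier \<open>\<mu>\<close> is only \<open>\<epsilon>\<close>-optimal, and its norm may blow up as \<open>\<epsilon> \<rightarrow> 0\<close>.
\<close>

theorem strong_duality:
  fixes A :: "'a \<Rightarrow>\<^sub>L 'b::real_inner"
  assumes "xdag \<in> D" "A xdag = y" "\<And>z. z \<in> D \<Longrightarrow> A z = y \<Longrightarrow> f xdag \<le> f z" "\<epsilon> > 0"
  obtains \<mu> where "dual_objective A y \<mu> < - f xdag + \<epsilon>"
proof -
  obtain u and n :: nat where u: "u \<in> D"
    and min: "\<And>w. w \<in> D \<Longrightarrow> penalized A y n u \<le> penalized A y n w" and near: "f xdag - \<epsilon> < f u"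
    using penalized_minimizers_approach[OF assms] by blast
  define \<mu> where "\<mu> = (- 2 * real n) *\<^sub>R (A u - y)"
  have "real_conjugate (dual_adjoint A \<mu>) = dual_adjoint A \<mu> u - f u"
    unfolding \<mu>_def using penalized_minimizer_subgradient[OF u min] by (intro real_conjugate_eq u)
  then have "dual_objective A y \<mu> = inner \<mu> (A u - y) - f u"
    by (simp add: dual_objective_def dual_adjoint_def inner_diff_right)
  also have "inner \<mu> (A u - y) \<le> 0" by (simp add: \<mu>_def)
  finally have "dual_objective A y \<mu> < - f xdag + \<epsilon>" using near by simp
  then show ?thesis by (rule that)
qed

end

section \<open>The dual gradient flow\<close>

lemma bounded_linear_dual_adjoint: "bounded_linear (dual_adjoint A)"
proof -
  have "bounded_linear (\<lambda>\<eta>. blinfun_inner_right \<eta> o\<^sub>L A)"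
    by (rule bounded_linear_compose[OF
          bounded_bilinear.bounded_linear_left[OF bounded_bilinear_blinfun_compose]
          bounded_linear_blinfun_inner_right])
  moreover have "dual_adjoint A = (\<lambda>\<eta>. blinfun_inner_right \<eta> o\<^sub>L A)"
    by (rule ext) (simp add: dual_adjoint_def)
  ultimately show ?thesis by simp
qed

lemma dual_adjoint_apply [simp]: "dual_adjoint A \<eta> z = inner \<eta> (A z)"
  by (simp add: dual_adjoint_def)

lemma norm_difference_quotient_tendsto:
  fixes g :: "real \<Rightarrow> 'a::real_normed_vector"
  assumes "(g has_vector_derivative D) (at t within {t..})"
  shows "((\<lambda>h. norm (g (t + h) - g t) / h) \<longlongrightarrow> norm D) (at_right 0)"
proof -
  have "(g has_vector_derivative D) (at t within {t<..})"
    using assms by (rule has_vector_derivative_within_subset) auto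
  then have "((\<lambda>u. (1 / norm (u - t)) *\<^sub>R (g u - (g t + (u - t) *\<^sub>R D))) \<longlongrightarrow> 0) (at_right t)"
    unfolding has_vector_derivative_def has_derivative_within by simp
  then have "((\<lambda>h. (1 / \<bar>h\<bar>) *\<^sub>R (g (h + t) - (g t + h *\<^sub>R D))) \<longlongrightarrow> 0) (at_right 0)"
    unfolding filterlim_at_right_to_0[of _ _ t] by simp
  then have "((\<lambda>h. norm ((1 / \<bar>h\<bar>) *\<^sub>R (g (h + t) - (g t + h *\<^sub>R D)) + D)) \<longlongrightarrow> norm (0 + D)) (at_right 0)"
    by (intro tendsto_norm tendsto_add tendsto_const)
  moreover have "eventually (\<lambda>h. norm ((1 / \<bar>h\<bar>) *\<^sub>R (g (h + t) - (g t + h *\<^sub>R D)) + D)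
      = norm (g (t + h) - g t) / h) (at_right 0)"
  proof (rule eventually_mono[OF eventually_at_right_less])
    fix h :: real assume h: "0 < h"
    have "(1 / \<bar>h\<bar>) *\<^sub>R (g (h + t) - (g t + h *\<^sub>R D)) + D = (1 / h) *\<^sub>R (g (t + h) - g t)"
      using h by (simp add: scaleR_diff_right scaleR_add_right add.commute)
    then show "norm ((1 / \<bar>h\<bar>) *\<^sub>R (g (h + t) - (g t + h *\<^sub>R D)) + D) = norm (g (t + h) - g t) / h"
      using h by simp
  qed
  ultimately have "((\<lambda>h. norm (g (t + h) - g t) / h) \<longlongrightarrow> norm (0 + D)) (at_right 0)"
    by (rule Lim_transform_eventually)
  then show ?thesis by simp
qed

text \<open>
  The final error estimate at the stopping time, as a function of the accuracy \<open>\<epsilon>\<close> of an approximate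
  multiplier, its norm \<open>M\<close> and the noise level \<open>d\<close>. For fixed \<open>\<epsilon>\<close> and \<open>M\<close> it tends to a multiple of
  \<open>\<epsilon>\<close> as \<open>d \<rightarrow> 0\<close>.
\<close>

definition stopping_bound :: "real \<Rightarrow> real \<Rightarrow> real \<Rightarrow> real \<Rightarrow> real" where
  "stopping_bound \<tau> \<epsilon> M d = \<epsilon> + 3 * M * (\<tau> + 1) * d + (\<tau> + 1) * (2 * M * d + (\<epsilon> + 3 * M * d) / (\<tau> - 1))"

text \<open>
  One flow, with a single noise level \<open>\<delta>\<close> and data \<open>v\<close>. The optimality of \<open>xdag\<close> enters through the
  approximate multipliers \<open>\<mu>\<close> in the lemmas below.
\<close>

locale noisy_dual_flow = strongly_convex_functional D f c
  for D :: "'a::banach set" and f c +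
  fixes A :: "'a \<Rightarrow>\<^sub>L 'b::real_inner"
    and y v :: 'b and \<delta> :: real and xdag :: 'a
    and x :: "real \<Rightarrow> 'a" and lam :: "real \<Rightarrow> 'b"
  assumes xdag_dom: "xdag \<in> D"
    and A_xdag: "A xdag = y"
    and delta_pos: "\<delta> > 0"
    and noise: "norm (v - y) \<le> \<delta>"
    and x_continuous: "continuous_on {0..} x"
    and lam_0: "lam 0 = 0"
    and x_eq: "t \<ge> 0 \<Longrightarrow> x t = dual_point (dual_adjoint A (lam t))"
    and lam_derivative: "t \<ge> 0 \<Longrightarrow> (lam has_vector_derivative (v - A (x t))) (at t within {0..})"
begin

definition residual :: "real \<Rightarrow> real" where
  "residual t = norm (A (x t) - v)"

text \<open>
  By \<open>gap_eq\<close> below this is the Bregman distance of \<open>xdag\<close> and \<open>x t\<close>, written as a duality gap for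
  the exact data \<open>y\<close>. The flow decreases the objective for \<open>v\<close>, not for \<open>y\<close>; the difference is the source of all
  noise terms.
\<close>

definition gap :: "real \<Rightarrow> real" where
  "gap t = f xdag + dual_objective A y (lam t)"

lemma lam_derivative_at: "t > 0 \<Longrightarrow> (lam has_vector_derivative (v - A (x t))) (at t)"
  using lam_derivative[of t] at_within_open_subset[of t "{0<..}" "{0..}"] by (simp add: subset_iff)

lemma lam_continuous: "continuous_on {0..} lam"
  using lam_derivative by (intro continuous_on_vector_derivative) auto

lemma dual_objective_derivative:
  assumes t: "t > 0"
  shows "((\<lambda>t. dual_objective A w (lam t)) has_real_derivative inner (v - A (x t)) (A (x t) - w)) (at t)"
proof -
  let ?d = "v - A (x t)"
  have lam': "(lam has_derivative (\<lambda>h. h *\<^sub>R ?d)) (at t)"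
    using lam_derivative_at[OF t] by (simp add: has_vector_derivative_def)
  have "((\<lambda>t. dual_adjoint A (lam t)) has_derivative (\<lambda>h. dual_adjoint A (h *\<^sub>R ?d))) (at t)"
    by (rule bounded_linear.has_derivative[OF bounded_linear_dual_adjoint lam'])
  then have "((\<lambda>t. real_conjugate (dual_adjoint A (lam t)))
      has_derivative (\<lambda>h. dual_adjoint A (h *\<^sub>R ?d) (x t))) (at t)"
    using x_eq[of t] t has_derivative_compose[OF _ real_conjugate_has_derivative] by fastforce
  then have "((\<lambda>t. dual_objective A w (lam t))
      has_derivative (\<lambda>h. dual_adjoint A (h *\<^sub>R ?d) (x t) - inner (h *\<^sub>R ?d) w)) (at t)"
    unfolding dual_objective_def by (intro derivative_intros lam')
  then show ?thesis
    unfolding has_field_derivative_def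
    by (rule has_derivative_eq_rhs) (auto simp: inner_diff_right algebra_simps)
qed

lemma dual_objective_continuous: "continuous_on {0..} (\<lambda>t. dual_objective A w (lam t))"
proof -
  have rc: "continuous_on UNIV real_conjugate"
    using has_derivative_continuous[OF real_conjugate_has_derivative]
    by (simp add: continuous_on_eq_continuous_at)
  have "continuous_on {0..} (\<lambda>t. dual_adjoint A (lam t))"
    by (rule bounded_linear.continuous_on[OF bounded_linear_dual_adjoint lam_continuous])
  from continuous_on_compose2[OF rc this]
  show ?thesis unfolding dual_objective_def by (intro continuous_intros lam_continuous) auto
qed

lemma nonincreasing_on_half_line:
  fixes \<phi> :: "real \<Rightarrow> real"
  assumes "0 \<le> s" "s \<le> t" "continuous_on {0..} \<phi>"
    and "\<And>u. s < u \<Longrightarrow> u < t \<Longrightarrow> (\<phi> has_real_derivative \<phi>' u) (at u)"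
    and "\<And>u. s < u \<Longrightarrow> u < t \<Longrightarrow> \<phi>' u \<le> 0"
  shows "\<phi> t \<le> \<phi> s"
proof (rule DERIV_nonpos_imp_decreasing_open[OF assms(2)])
  show "continuous_on {s..t} \<phi>" using assms(3) by (rule continuous_on_subset) (use assms(1) in auto)
qed (use assms(4,5) in blast)

lemma dual_objective_convex:
  assumes "t \<ge> 0"
  shows "dual_objective A w (lam t) + inner (\<mu> - lam t) (A (x t) - w) \<le> dual_objective A w \<mu>"
  using real_conjugate_subgradient[of "dual_adjoint A (lam t)" "dual_adjoint A \<mu>"] x_eq[OF assms]
  by (simp add: dual_objective_def blinfun.diff_left inner_diff_left inner_diff_right)

lemma dual_objective_change_data:
  "dual_objective A y \<mu> = dual_objective A v \<mu> + inner \<mu> (v - y)"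
  by (simp add: dual_objective_def inner_diff_right)

lemma inner_noise_le: "\<bar>inner \<mu> (v - y)\<bar> \<le> norm \<mu> * \<delta>"
  using Cauchy_Schwarz_ineq2[of \<mu> "v - y"] mult_left_mono[OF noise, of "norm \<mu>"] by simp

lemma gap_eq:
  assumes "t \<ge> 0"
  shows "gap t = f xdag - f (x t) - inner (lam t) (y - A (x t))"
  by (simp add: gap_def dual_objective_def real_conjugate_def x_eq[OF assms] inner_diff_right)

lemma gap_ge: "t \<ge> 0 \<Longrightarrow> c * (norm (x t - xdag))\<^sup>2 \<le> gap t"
  using bregman_lower_bound[OF xdag_dom, of "dual_adjoint A (lam t)"]
  by (simp add: gap_def dual_objective_def x_eq A_xdag norm_minus_commute algebra_simps)

lemma gap_nonneg: "t \<ge> 0 \<Longrightarrow> 0 \<le> gap t"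
  using gap_ge[of t] mult_nonneg_nonneg[OF less_imp_le[OF c_pos], of "(norm (x t - xdag))\<^sup>2"]
  by simp

section \<open>Monotone quantities and the discrepancy principle\<close>

text \<open>
  The gradient of a convex function is monotone, so two trajectories of its gradient flow do not
  separate; here a trajectory is compared with its own translate.
\<close>

lemma increments_nonincreasing:
  assumes "0 \<le> s" "s \<le> t" "h \<ge> 0"
  shows "norm (lam (t + h) - lam t) \<le> norm (lam (s + h) - lam s)"
proof -
  let ?d = "\<lambda>u. lam (u + h) - lam u"
  let ?d' = "\<lambda>u. A (x u) - A (x (u + h))"
  have "inner (?d t) (?d t) \<le> inner (?d s) (?d s)"
  proof (rule nonincreasing_on_half_line[OF assms(1,2), where \<phi>' = "\<lambda>u. 2 * inner (?d u) (?d' u)"])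
    have "continuous_on {0..} (\<lambda>u. lam (u + h))"
      by (rule continuous_on_compose2[OF lam_continuous])
        (use assms in \<open>auto intro!: continuous_intros\<close>)
    then show "continuous_on {0..} (\<lambda>u. inner (?d u) (?d u))"
      by (intro continuous_intros lam_continuous)
  next
    fix u assume u: "s < u" "u < t"
    have "((\<lambda>u. u + h) has_vector_derivative 1) (at u)"
      by (auto intro!: derivative_eq_intros)
    moreover have "(lam has_vector_derivative (v - A (x (u + h)))) (at (u + h))"
      using assms u by (intro lam_derivative_at) auto
    ultimately have "((\<lambda>u. lam (u + h)) has_vector_derivative (v - A (x (u + h)))) (at u)"
      using vector_diff_chain_at[of "\<lambda>u. u + h" 1 u lam] by (simp add: o_def)
    then have d: "(?d has_vector_derivative ((v - A (x (u + h))) - (v - A (x u)))) (at u)"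
      using assms u by (intro derivative_intros lam_derivative_at) auto
    have "((\<lambda>u. inner (?d u) (?d u)) has_vector_derivative 2 * inner (?d u) (?d' u)) (at u)"
      using bounded_bilinear.has_vector_derivative[OF bounded_bilinear_inner d d]
      by (simp add: inner_commute)
    then show "((\<lambda>u. inner (?d u) (?d u)) has_real_derivative 2 * inner (?d u) (?d' u)) (at u)"
      by (simp add: has_real_derivative_iff_has_vector_derivative)
    have "dual_objective A 0 (lam u) + inner (lam (u + h) - lam u) (A (x u)) \<le> dual_objective A 0 (lam (u + h))"
      using dual_objective_convex[of u 0 "lam (u + h)"] assms u by simp
    moreover have "dual_objective A 0 (lam (u + h)) + inner (lam u - lam (u + h)) (A (x (u + h))) \<le> dual_objective A 0 (lam u)"
      using dual_objective_convex[of "u + h" 0 "lam u"] assms u by simp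
    ultimately show "2 * inner (?d u) (?d' u) \<le> 0"
      by (simp add: inner_diff_left inner_diff_right)
  qed
  then show ?thesis by (simp add: norm_le)
qed

text \<open>
  The residual is the speed of \<open>lam\<close>, hence the limit of \<open>norm (lam (t + h) - lam t) / h\<close>.
\<close>

lemma residual_nonincreasing:
  assumes "0 \<le> s" "s \<le> t"
  shows "residual t \<le> residual s"
proof -
  have q: "((\<lambda>h. norm (lam (u + h) - lam u) / h) \<longlongrightarrow> residual u) (at_right 0)" if "u \<ge> 0" for u
    unfolding residual_def norm_minus_commute[of "A (x u)" v]
    by (rule norm_difference_quotient_tendsto, rule has_vector_derivative_within_subset[OF lam_derivative])
      (use that in auto)
  have "eventually (\<lambda>h. norm (lam (t + h) - lam t) / h \<le> norm (lam (s + h) - lam s) / h) (at_right 0)"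
    by (rule eventually_mono[OF eventually_at_right_less])
      (use increments_nonincreasing[OF assms] in \<open>auto intro!: divide_right_mono\<close>)
  then show ?thesis
    using q[of t] q[of s] assms by (intro tendsto_le[OF _ q[of s] q[of t]]) auto
qed

text \<open>
  The left-hand side is the derivative of \<open>gap\<close>: the exact gap decreases as long as the residual
  exceeds the noise level.
\<close>

lemma gap_slope:
  assumes "u > 0"
  shows "inner (v - A (x u)) (A (x u) - y) \<le> - residual u * (residual u - \<delta>)"
proof -
  have "inner (v - A (x u)) (A (x u) - y)
      = - (inner (v - A (x u)) (v - A (x u))) + inner (v - A (x u)) (v - y)"
    by (simp add: inner_diff_right algebra_simps)
  also have "inner (v - A (x u)) (v - A (x u)) = residual u * residual u"
    by (simp add: residual_def norm_minus_commute power2_norm_eq_inner[symmetric] power2_eq_square)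
  also have "inner (v - A (x u)) (v - y) \<le> residual u * \<delta>"
    using inner_noise_le[of "v - A (x u)"] by (simp add: residual_def norm_minus_commute)
  finally show ?thesis by (simp add: algebra_simps)
qed

text \<open>
  While the residual \<open>r\<close> is at least \<open>\<rho>\<close>, the gap decreases at rate \<open>r * (r - \<delta>) \<ge> (\<rho> - \<delta>) * r\<close>, and \<open>r\<close> is
  the speed of \<open>lam\<close>. To avoid differentiating a norm, the displacement is measured along its fixed
  final direction \<open>e\<close>. With \<open>\<rho> = \<tau> * \<delta>\<close> the margin
  \<open>\<tau> - 1\<close> enters the error bound here.
\<close>

lemma gap_decrease_ge_displacement:
  assumes "0 \<le> s" "s \<le> t" "\<delta> \<le> \<rho>" and \<rho>: "\<And>u. s < u \<Longrightarrow> u < t \<Longrightarrow> \<rho> \<le> residual u"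
  shows "(\<rho> - \<delta>) * norm (lam t - lam s) \<le> gap s - gap t"
proof -
  define e where "e = sgn (lam t - lam s)"
  have e: "norm e \<le> 1" by (simp add: e_def norm_sgn)
  have "gap t + (\<rho> - \<delta>) * inner (lam t) e \<le> gap s + (\<rho> - \<delta>) * inner (lam s) e"
  proof (rule nonincreasing_on_half_line[OF assms(1,2),
        where \<phi>' = "\<lambda>u. inner (v - A (x u)) (A (x u) - y) + (\<rho> - \<delta>) * inner (v - A (x u)) e"])
    show "continuous_on {0..} (\<lambda>u. gap u + (\<rho> - \<delta>) * inner (lam u) e)"
      unfolding gap_def by (intro continuous_intros lam_continuous dual_objective_continuous)
  next
    fix u assume u: "s < u" "u < t"
    with assms have u0: "u > 0" by simp
    have "((\<lambda>u. inner (lam u) e) has_vector_derivative inner (v - A (x u)) e) (at u)"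
      by (rule bounded_linear.has_vector_derivative[OF bounded_linear_inner_left lam_derivative_at[OF u0]])
    then have "((\<lambda>u. inner (lam u) e) has_real_derivative inner (v - A (x u)) e) (at u)"
      by (simp add: has_real_derivative_iff_has_vector_derivative)
    then show "((\<lambda>u. gap u + (\<rho> - \<delta>) * inner (lam u) e) has_real_derivative
        inner (v - A (x u)) (A (x u) - y) + (\<rho> - \<delta>) * inner (v - A (x u)) e) (at u)"
      unfolding gap_def
      by (auto intro!: derivative_eq_intros dual_objective_derivative[OF u0])
    have "inner (v - A (x u)) e \<le> residual u * 1"
      using norm_cauchy_schwarz[of "v - A (x u)" e] mult_left_mono[OF e, of "norm (v - A (x u))"]
      by (simp add: residual_def norm_minus_commute)
    then have "(\<rho> - \<delta>) * inner (v - A (x u)) e \<le> (\<rho> - \<delta>) * residual u"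
      using assms(3) by (intro mult_left_mono) auto
    moreover have "0 \<le> residual u * (residual u - \<rho>)"
      using \<rho>[OF u] by (intro mult_nonneg_nonneg) (auto simp: residual_def)
    ultimately show "inner (v - A (x u)) (A (x u) - y) + (\<rho> - \<delta>) * inner (v - A (x u)) e \<le> 0"
      using gap_slope[OF u0] by (simp add: algebra_simps)
  qed
  then have "(\<rho> - \<delta>) * inner (lam t - lam s) e \<le> gap s - gap t"
    by (simp add: inner_diff_left algebra_simps)
  also have "inner (lam t - lam s) e = norm (lam t - lam s)"
    by (cases "lam t = lam s")
      (simp_all add: e_def sgn_div_norm power2_norm_eq_inner[symmetric] power2_eq_square)
  finally show ?thesis .
qed

lemma gap_decrease_ge_time:
  assumes "0 \<le> t" "\<delta> \<le> \<rho>" and \<rho>: "\<And>u. 0 < u \<Longrightarrow> u < t \<Longrightarrow> \<rho> \<le> residual u"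
  shows "\<rho> * (\<rho> - \<delta>) * t \<le> gap 0 - gap t"
proof -
  have "gap t + \<rho> * (\<rho> - \<delta>) * t \<le> gap 0 + \<rho> * (\<rho> - \<delta>) * 0"
  proof (rule nonincreasing_on_half_line[OF order_refl assms(1),
        where \<phi>' = "\<lambda>u. inner (v - A (x u)) (A (x u) - y) + \<rho> * (\<rho> - \<delta>)"])
    show "continuous_on {0..} (\<lambda>u. gap u + \<rho> * (\<rho> - \<delta>) * u)"
      unfolding gap_def by (intro continuous_intros dual_objective_continuous)
  next
    fix u :: real assume u: "0 < u" "u < t"
    show "((\<lambda>u. gap u + \<rho> * (\<rho> - \<delta>) * u) has_real_derivative
        inner (v - A (x u)) (A (x u) - y) + \<rho> * (\<rho> - \<delta>)) (at u)"
      unfolding gap_def by (auto intro!: derivative_eq_intros dual_objective_derivative[OF u(1)])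
    have "\<rho> * (\<rho> - \<delta>) \<le> residual u * (residual u - \<delta>)"
      using \<rho>[OF u] assms(2) delta_pos by (intro mult_mono) auto
    then show "inner (v - A (x u)) (A (x u) - y) + \<rho> * (\<rho> - \<delta>) \<le> 0"
      using gap_slope[OF u(1)] by simp
  qed
  then show ?thesis by simp
qed

text \<open>
  If the residual stayed above \<open>\<tau> * \<delta>\<close>, the gap would decrease at least linearly and become negative.
\<close>

lemma discrepancy_time_exists:
  assumes \<tau>: "\<tau> > 1"
  shows "\<exists>T. discrepancy_time A \<tau> \<delta> v x T"
proof (cases "residual 0 \<le> \<tau> * \<delta>")
  case True
  then show ?thesis by (auto simp: discrepancy_time_def residual_def)
next
  case False
  define \<rho> where "\<rho> = \<tau> * \<delta>"
  have \<rho>: "\<delta> < \<rho>" using \<tau> delta_pos by (simp add: \<rho>_def)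
  have "\<exists>t\<ge>0. residual t \<le> \<rho>"
  proof (rule ccontr)
    assume "\<not> ?thesis"
    then have big: "\<rho> \<le> residual u" if "u \<ge> 0" for u using that by (meson linear)
    define k where "k = \<rho> * (\<rho> - \<delta>)"
    have pos: "k > 0" using \<rho> delta_pos by (simp add: k_def)
    define t where "t = (gap 0 + 1) / k"
    have t: "0 \<le> t" using gap_nonneg[of 0] pos by (simp add: t_def)
    have "\<rho> * (\<rho> - \<delta>) * t \<le> gap 0 - gap t"
      using t \<rho> big by (intro gap_decrease_ge_time) auto
    then have "k * t \<le> gap 0 - gap t" by (simp only: k_def)
    moreover have "k * t = gap 0 + 1" using pos by (simp add: t_def)
    ultimately show False using gap_nonneg[OF t] by simp
  qed
  then obtain t where t: "t \<ge> 0" "residual t \<le> \<rho>" by blast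
  have "continuous_on {0..t} residual"
    unfolding residual_def
    by (intro continuous_intros continuous_on_subset[OF x_continuous]) auto
  then obtain T where "0 \<le> T" "T \<le> t" "residual T = \<rho>"
    using IVT2'[of residual t \<rho> 0] t False by (auto simp: \<rho>_def)
  then show ?thesis using False
    by (intro exI[of _ T]) (auto simp: discrepancy_time_def residual_def \<rho>_def less_le)
qed

lemma discrepancy_time_props:
  assumes "discrepancy_time A \<tau> \<delta> v x T"
  shows "T \<ge> 0" "residual T \<le> \<tau> * \<delta>" "0 < u \<Longrightarrow> u < T \<Longrightarrow> \<tau> * \<delta> \<le> residual u"
  using assms residual_nonincreasing[of u T]
  by (auto simp: discrepancy_time_def residual_def split: if_splits)

section \<open>Comparison with an approximate multiplier\<close>

text \<open>
  As long as the objective is above its value at \<open>\<mu>\<close>, the flow does not move away from \<open>\<mu>\<close>; and the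
  objective decreases along the flow, so it was above that value at all earlier times.
\<close>

lemma lam_bounded_above_level:
  assumes "0 \<le> s" and level: "dual_objective A v \<mu> \<le> dual_objective A v (lam s)"
  shows "norm (lam s) \<le> 2 * norm \<mu>"
proof -
  have above: "dual_objective A v \<mu> \<le> dual_objective A v (lam u)" if u: "0 < u" "u < s" for u
  proof -
    have "dual_objective A v (lam s) \<le> dual_objective A v (lam u)"
    proof (rule nonincreasing_on_half_line[where s = u and t = s and
          \<phi> = "\<lambda>t. dual_objective A v (lam t)" and \<phi>' = "\<lambda>u. inner (v - A (x u)) (A (x u) - v)"])
      show "continuous_on {0..} (\<lambda>t. dual_objective A v (lam t))" by (rule dual_objective_continuous)
      fix r assume "u < r"
      with u show "((\<lambda>t. dual_objective A v (lam t)) has_real_derivative inner (v - A (x r)) (A (x r) - v)) (at r)"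
        by (intro dual_objective_derivative) auto
      have "inner (v - A (x r)) (A (x r) - v) = - inner (v - A (x r)) (v - A (x r))"
        by (simp add: inner_diff_right)
      then show "inner (v - A (x r)) (A (x r) - v) \<le> 0" by simp
    qed (use u in auto)
    with level show ?thesis by simp
  qed
  have "inner (lam s - \<mu>) (lam s - \<mu>) \<le> inner (lam 0 - \<mu>) (lam 0 - \<mu>)"
  proof (rule nonincreasing_on_half_line[OF order_refl assms(1), where \<phi>' = "\<lambda>u. 2 * inner (lam u - \<mu>) (v - A (x u))"])
    show "continuous_on {0..} (\<lambda>u. inner (lam u - \<mu>) (lam u - \<mu>))"
      by (intro continuous_intros lam_continuous)
  next
    fix u assume u: "0 < u" "u < s"
    have d: "((\<lambda>u. lam u - \<mu>) has_vector_derivative (v - A (x u))) (at u)"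
      using has_vector_derivative_diff[OF lam_derivative_at[OF u(1)] has_vector_derivative_const[of \<mu>]] by simp
    have "((\<lambda>u. inner (lam u - \<mu>) (lam u - \<mu>)) has_vector_derivative 2 * inner (lam u - \<mu>) (v - A (x u))) (at u)"
      using bounded_bilinear.has_vector_derivative[OF bounded_bilinear_inner d d]
      by (simp add: inner_commute)
    then show "((\<lambda>u. inner (lam u - \<mu>) (lam u - \<mu>)) has_real_derivative 2 * inner (lam u - \<mu>) (v - A (x u))) (at u)"
      by (simp add: has_real_derivative_iff_has_vector_derivative)
    have "inner (lam u - \<mu>) (v - A (x u)) = inner (\<mu> - lam u) (A (x u) - v)"
      by (simp add: inner_diff_left inner_diff_right)
    then show "2 * inner (lam u - \<mu>) (v - A (x u)) \<le> 0"
      using dual_objective_convex[of u v \<mu>] above[OF u] u by simp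
  qed
  then have "norm (lam s - \<mu>) \<le> norm \<mu>" by (simp add: norm_le lam_0)
  then show ?thesis using norm_triangle_sub[of "lam s" \<mu>] by simp
qed

text \<open>
  The time \<open>s\<close> is the stopping time \<open>T\<close> if the objective for \<open>v\<close> is then still above its value at \<open>\<mu>\<close>;
  otherwise it is a time at which that value is reached (or \<open>0\<close>, if the flow starts below it). In the
  second case passing from \<open>v\<close> to \<open>y\<close> costs \<open>norm \<mu> * \<delta>\<close> for \<open>\<mu>\<close> and \<open>2 * norm \<mu> * \<delta>\<close> for \<open>lam s\<close>.
\<close>

lemma early_time_with_small_gap:
  assumes T: "T \<ge> 0" and \<mu>: "dual_objective A y \<mu> \<le> - f xdag + \<epsilon>"
  obtains s where "0 \<le> s" "s \<le> T" "norm (lam s) \<le> 2 * norm \<mu>"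
    "s = T \<or> gap s \<le> \<epsilon> + 3 * norm \<mu> * \<delta>"
proof -
  let ?d = "dual_objective A v"
  have d\<mu>: "f xdag + ?d \<mu> \<le> \<epsilon> + norm \<mu> * \<delta>"
    using \<mu> inner_noise_le[of \<mu>] dual_objective_change_data[of \<mu>] by linarith
  have small: "gap s \<le> \<epsilon> + 3 * norm \<mu> * \<delta>"
    if "norm (lam s) \<le> 2 * norm \<mu>" "?d (lam s) \<le> ?d \<mu>" for s
  proof -
    have "norm (lam s) * \<delta> \<le> 2 * norm \<mu> * \<delta>"
      using that(1) delta_pos by (intro mult_right_mono) auto
    then show ?thesis
      using that(2) d\<mu> inner_noise_le[of "lam s"] dual_objective_change_data[of "lam s"]
      by (simp add: gap_def)
  qed
  consider "?d \<mu> \<le> ?d (lam T)" | "?d (lam 0) \<le> ?d \<mu>" | "?d (lam T) \<le> ?d \<mu>" "?d \<mu> \<le> ?d (lam 0)"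
    by linarith
  then show ?thesis
  proof cases
    case 1
    then show ?thesis using lam_bounded_above_level[OF T 1] T by (intro that[of T]) auto
  next
    case 2
    then show ?thesis using small[of 0] T by (intro that[of 0]) (auto simp: lam_0)
  next
    case 3
    have "continuous_on {0..T} (\<lambda>t. ?d (lam t))"
      by (rule continuous_on_subset[OF dual_objective_continuous]) auto
    then obtain s where s: "0 \<le> s" "s \<le> T" "?d (lam s) = ?d \<mu>"
      using IVT2'[of "\<lambda>t. ?d (lam t)" T "?d \<mu>" 0] 3 T by blast
    then have "norm (lam s) \<le> 2 * norm \<mu>" by (intro lam_bounded_above_level) auto
    then show ?thesis using s small[of s] by (intro that[of s]) auto
  qed
qed

text \<open>
  Weak duality: an approximate multiplier bounds \<open>f\<close> from below also at points that violate the
  constraint slightly.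
\<close>

lemma objective_lower_bound:
  assumes z: "z \<in> D" and \<mu>: "dual_objective A y \<mu> \<le> - f xdag + \<epsilon>"
  shows "f xdag - \<epsilon> - norm \<mu> * norm (A z - y) \<le> f z"
  using fenchel_young[OF z, of "dual_adjoint A \<mu>"] \<mu> Cauchy_Schwarz_ineq2[of \<mu> "A z - y"]
  by (simp add: dual_objective_def inner_diff_right)

text \<open>
  The product \<open>\<delta> * norm (lam T)\<close> has to be small, although \<open>lam T\<close> itself may be unbounded as
  \<open>\<delta> \<rightarrow> 0\<close>. Up to the time \<open>s\<close> of \<open>early_time_with_small_gap\<close> the multiplier is bounded by \<open>2 * norm \<mu>\<close>,
  and from then on its displacement is at most \<open>gap s / ((\<tau> - 1) * \<delta>)\<close>. If \<open>s = T\<close>, the smallness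
  of the gap comes instead from the small residual at \<open>T\<close> together with the lower bound on \<open>f\<close>.
\<close>

lemma stopping_estimate:
  assumes \<tau>: "\<tau> > 1" and T: "discrepancy_time A \<tau> \<delta> v x T"
    and \<epsilon>: "\<epsilon> > 0" and \<mu>: "dual_objective A y \<mu> \<le> - f xdag + \<epsilon>"
  shows "gap T \<le> stopping_bound \<tau> \<epsilon> (norm \<mu>) \<delta>"
    and "\<bar>f (x T) - f xdag\<bar> \<le> stopping_bound \<tau> \<epsilon> (norm \<mu>) \<delta>"
proof -
  define M where "M = norm \<mu>"
  have M: "M \<ge> 0" by (simp add: M_def)
  note T' = discrepancy_time_props[OF T]
  have \<tau>\<delta>: "\<delta> \<le> \<tau> * \<delta>" using \<tau> delta_pos by simp
  have xT: "x T \<in> D" using x_eq[OF T'(1)] dual_point(1) by simp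
  have AxT: "norm (A (x T) - y) \<le> (\<tau> + 1) * \<delta>"
    using norm_triangle_ineq[of "A (x T) - v" "v - y"] T'(2) noise by (simp add: residual_def algebra_simps)
  obtain s where s: "0 \<le> s" "s \<le> T" "norm (lam s) \<le> 2 * M" "s = T \<or> gap s \<le> \<epsilon> + 3 * M * \<delta>"
    using early_time_with_small_gap[OF T'(1) \<mu>] unfolding M_def by blast
  have disp: "(\<tau> - 1) * \<delta> * norm (lam T - lam s) \<le> gap s - gap T"
    using gap_decrease_ge_displacement[OF s(1,2) \<tau>\<delta>] T'(3) s(1) by (simp add: left_diff_distrib)
  have lower: "f xdag - \<epsilon> - M * ((\<tau> + 1) * \<delta>) \<le> f (x T)"
    using objective_lower_bound[OF xT \<mu>] mult_left_mono[OF AxT M] by (simp add: M_def)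
  have pairing: "\<bar>inner (lam T) (y - A (x T))\<bar> \<le> norm (lam T) * ((\<tau> + 1) * \<delta>)"
    using Cauchy_Schwarz_ineq2[of "lam T" "y - A (x T)"]
      mult_left_mono[OF AxT, of "norm (lam T)"] by (simp add: norm_minus_commute)
  have pos: "0 \<le> M * \<delta>" "0 \<le> M * \<delta> * \<tau>" "0 \<le> (\<epsilon> + 3 * M * \<delta>) / (\<tau> - 1)"
    using M delta_pos \<tau> \<epsilon> by auto
  have lamT: "\<delta> * norm (lam T) \<le> 2 * M * \<delta> + (\<epsilon> + 3 * M * \<delta>) / (\<tau> - 1)"
  proof (cases "s = T")
    case True
    then have "\<delta> * norm (lam T) \<le> \<delta> * (2 * M)" using s(3) delta_pos by (intro mult_left_mono) auto
    moreover have "\<delta> * (2 * M) = 2 * M * \<delta>" by simp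
    ultimately show ?thesis using pos(3) by linarith
  next
    case False
    have "(\<tau> - 1) * (\<delta> * norm (lam T - lam s)) \<le> \<epsilon> + 3 * M * \<delta>"
      using disp gap_nonneg[OF T'(1)] s(4) False by (simp add: mult.assoc)
    then have "\<delta> * norm (lam T - lam s) \<le> (\<epsilon> + 3 * M * \<delta>) / (\<tau> - 1)"
      using \<tau> by (simp add: pos_le_divide_eq mult.commute)
    moreover have "\<delta> * norm (lam T) \<le> \<delta> * (2 * M + norm (lam T - lam s))"
      using norm_triangle_sub[of "lam T" "lam s"] s(3) delta_pos by (intro mult_left_mono) auto
    ultimately show ?thesis by (simp add: algebra_simps)
  qed
  have gapT: "gap T \<le> \<epsilon> + 3 * M * (\<tau> + 1) * \<delta>"
  proof (cases "s = T")
    case True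
    have "norm (lam T) * ((\<tau> + 1) * \<delta>) \<le> 2 * M * ((\<tau> + 1) * \<delta>)"
      using s(3) True delta_pos \<tau> by (intro mult_right_mono) auto
    then show ?thesis using gap_eq[OF T'(1)] lower pairing by (simp add: algebra_simps)
  next
    case False
    have "0 \<le> (\<tau> - 1) * \<delta> * norm (lam T - lam s)" using \<tau> delta_pos by simp
    then have "gap T \<le> \<epsilon> + 3 * M * \<delta>" using disp s(4) False by linarith
    then show ?thesis using pos(2) by (simp add: algebra_simps)
  qed
  have prod: "0 \<le> (\<tau> + 1) * (2 * M * \<delta> + (\<epsilon> + 3 * M * \<delta>) / (\<tau> - 1))"
    using pos \<tau> by (intro mult_nonneg_nonneg) auto
  show "gap T \<le> stopping_bound \<tau> \<epsilon> (norm \<mu>) \<delta>"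
    using gapT prod by (simp add: stopping_bound_def M_def)
  have "norm (lam T) * ((\<tau> + 1) * \<delta>) \<le> (\<tau> + 1) * (2 * M * \<delta> + (\<epsilon> + 3 * M * \<delta>) / (\<tau> - 1))"
    using mult_left_mono[OF lamT, of "\<tau> + 1"] \<tau> by (simp add: mult_ac)
  then have "f (x T) - f xdag \<le> (\<tau> + 1) * (2 * M * \<delta> + (\<epsilon> + 3 * M * \<delta>) / (\<tau> - 1))"
    using gap_eq[OF T'(1)] gap_nonneg[OF T'(1)] pairing by linarith
  moreover have "0 \<le> 3 * M * (\<tau> + 1) * \<delta>" "M * ((\<tau> + 1) * \<delta>) \<le> 3 * M * (\<tau> + 1) * \<delta>"
    using pos(1,2) by (auto simp: algebra_simps)
  ultimately show "\<bar>f (x T) - f xdag\<bar> \<le> stopping_bound \<tau> \<epsilon> (norm \<mu>) \<delta>"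
    using lower prod \<epsilon> unfolding stopping_bound_def M_def[symmetric] by linarith
qed

end

section \<open>Extended-real functionals\<close>

text \<open>
  The lower limit at \<open>l\<close> ignores \<open>l\<close> itself, so a sequence that returns to \<open>l\<close> is covered by the trivial
  bound \<open>q < R l\<close>: punctured neighbourhoods extend to full ones.
\<close>

lemma lower_semicontinuous_sequentially:
  fixes R :: "'a::metric_space \<Rightarrow> ereal"
  assumes lsc: "lower_semicontinuous R" and X: "X \<longlonglongrightarrow> l"
    and le: "\<And>n::nat. R (X n) \<le> b n" and b: "b \<longlonglongrightarrow> m"
  shows "R l \<le> m"
proof (rule ccontr)
  assume "\<not> R l \<le> m"
  then obtain q where q: "m < q" "q < R l" using dense by (metis not_le)
  then have "q < Liminf (at l) R" using lsc by (auto simp: lower_semicontinuous_def intro: less_le_trans)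
  then have "eventually (\<lambda>z. q < R z) (at l)" by (rule less_LiminfD)
  then have "eventually (\<lambda>z. q < R z) (nhds l)"
    using q(2) by (auto simp: eventually_at_filter elim: eventually_mono)
  then have "eventually (\<lambda>n. q < R (X n)) sequentially"
    using X by (rule eventually_compose_filterlim)
  moreover have "eventually (\<lambda>n. b n < q) sequentially" using b q(1) by (rule order_tendstoD)
  ultimately have "eventually (\<lambda>n. False) sequentially"
    by eventually_elim (meson le less_asym less_le_trans)
  then show False by simp
qed

lemma proper_on_domain:
  assumes "proper_functional R"
  shows "z \<in> effective_domain R \<Longrightarrow> R z = ereal (real_of_ereal (R z))"
    and "z \<notin> effective_domain R \<Longrightarrow> R z = \<infinity>"
  using assms by (auto simp: proper_functional_def effective_domain_def ereal_real less_top[symmetric])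

lemma strongly_convex_functional_of_ereal:
  fixes R :: "'a::banach \<Rightarrow> ereal"
  assumes proper: "proper_functional R" and lsc: "lower_semicontinuous R" and "strongly_convex R"
  obtains c where "strongly_convex_functional (effective_domain R) (\<lambda>z. real_of_ereal (R z)) c"
proof -
  let ?D = "effective_domain R" and ?f = "\<lambda>z. real_of_ereal (R z)"
  note fin = proper_on_domain(1)[OF proper]
  obtain c where c: "c > 0" and conv: "\<And>x z \<gamma>. x \<in> ?D \<Longrightarrow> z \<in> ?D \<Longrightarrow> \<gamma> \<in> {0..1} \<Longrightarrow>
      R (\<gamma> *\<^sub>R x + (1 - \<gamma>) *\<^sub>R z) + ereal (c * \<gamma> * (1 - \<gamma>) * (norm (x - z))\<^sup>2)
        \<le> ereal \<gamma> * R x + ereal (1 - \<gamma>) * R z"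
    using assms(3) unfolding strongly_convex_def by blast
  have real_conv: "R (\<gamma> *\<^sub>R x + (1 - \<gamma>) *\<^sub>R z) + ereal (c * \<gamma> * (1 - \<gamma>) * (norm (x - z))\<^sup>2)
        \<le> ereal (\<gamma> * ?f x + (1 - \<gamma>) * ?f z)"
    if "x \<in> ?D" "z \<in> ?D" "0 \<le> \<gamma>" "\<gamma> \<le> 1" for x z \<gamma>
    using conv[OF that(1,2), of \<gamma>] that fin[OF that(1)] fin[OF that(2)]
    by (metis atLeastAtMost_iff plus_ereal.simps(1) times_ereal.simps(1))
  have dom: "\<gamma> *\<^sub>R x + (1 - \<gamma>) *\<^sub>R z \<in> ?D"
    if "x \<in> ?D" "z \<in> ?D" "0 \<le> \<gamma>" "\<gamma> \<le> 1" for x z \<gamma>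
    using real_conv[OF that] proper_on_domain(2)[OF proper, of "\<gamma> *\<^sub>R x + (1 - \<gamma>) *\<^sub>R z"] by force
  have "strongly_convex_functional ?D ?f c"
  proof (unfold_locales, goal_cases)
    case 1 show ?case using proper by (simp add: proper_functional_def)
  next
    case 2 show ?case by (rule c)
  next
    case (3 x z \<gamma>) then show ?case by (rule dom)
  next
    case (4 x z \<gamma>)
    have "ereal (?f (\<gamma> *\<^sub>R x + (1 - \<gamma>) *\<^sub>R z)) + ereal (c * \<gamma> * (1 - \<gamma>) * (norm (x - z))\<^sup>2)
        \<le> ereal (\<gamma> * ?f x + (1 - \<gamma>) * ?f z)"
      using real_conv[OF 4] unfolding fin[OF dom[OF 4], symmetric] .
    then show ?case by simp
  next
    case (5 X l b m)
    have "R (X n) \<le> ereal (b n)" for n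
      by (subst fin[OF 5(1)]) (use 5(3) in simp)
    then have le: "R l \<le> ereal m"
      by (rule lower_semicontinuous_sequentially[OF lsc 5(2)]) (use 5(4) in simp)
    then have lD: "l \<in> ?D" by (auto simp: effective_domain_def intro: le_less_trans)
    then have "ereal (?f l) \<le> ereal m" using le fin[OF lD] by simp
    then show ?case using lD by simp
  qed
  then show ?thesis by (rule that)
qed

text \<open>
  The definite description in \<^const>\<open>conjugate_gradient\<close> denotes something: the minimizer of
  \<open>R - \<xi>\<close> represents the derivative, and it is the only point to do so because the dual space separates points.
\<close>

lemma conjugate_gradient_eq_dual_point:
  fixes R :: "'a::banach \<Rightarrow> ereal"
  assumes proper: "proper_functional R"
    and sc: "strongly_convex_functional (effective_domain R) (\<lambda>z. real_of_ereal (R z)) c"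
  shows "conjugate_gradient R \<xi>
    = strongly_convex_functional.dual_point (effective_domain R) (\<lambda>z. real_of_ereal (R z)) c \<xi>"
proof -
  let ?D = "effective_domain R" and ?f = "\<lambda>z. real_of_ereal (R z)"
  interpret strongly_convex_functional ?D ?f c by (rule sc)
  have "conjugate R \<zeta> = ereal (real_conjugate \<zeta>)" for \<zeta> :: "'a \<Rightarrow>\<^sub>L real"
    unfolding conjugate_def
  proof (rule antisym)
    show "(SUP z. ereal (\<zeta> z) - R z) \<le> ereal (real_conjugate \<zeta>)"
    proof (rule SUP_least)
      fix z show "ereal (\<zeta> z) - R z \<le> ereal (real_conjugate \<zeta>)"
      proof (cases "z \<in> ?D")
        case True
        then show ?thesis
          using fenchel_young[OF True, of \<zeta>] by (subst proper_on_domain(1)[OF proper True]) simp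
      next
        case False
        then show ?thesis by (simp add: proper_on_domain(2)[OF proper])
      qed
    qed
    have "ereal (real_conjugate \<zeta>) = ereal (\<zeta> (dual_point \<zeta>)) - R (dual_point \<zeta>)"
      by (subst proper_on_domain(1)[OF proper dual_point(1)]) (simp add: real_conjugate_def)
    then show "ereal (real_conjugate \<zeta>) \<le> (SUP z. ereal (\<zeta> z) - R z)"
      using SUP_upper[of "dual_point \<zeta>" UNIV "\<lambda>z. ereal (\<zeta> z) - R z"] by simp
  qed
  then have "(\<lambda>\<zeta>. real_of_ereal (conjugate R \<zeta>)) = real_conjugate" by auto
  then show ?thesis
    unfolding conjugate_gradient_def
    by (intro the_equality) (auto intro: real_conjugate_has_derivative derivative_representer_unique)
qed

text \<open>
  The order of choices matters: \<open>\<epsilon>\<close> is fixed before the multiplier, and therefore before its norm \<open>M\<close>.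
\<close>

lemma stopping_bound_eventually_small:
  assumes \<tau>: "\<tau> > 1" and \<kappa>: "\<kappa> > 0"
  obtains \<epsilon> where "\<epsilon> > 0"
    "\<And>M. eventually (\<lambda>\<delta>. stopping_bound \<tau> \<epsilon> M \<delta> < \<kappa>) (at_right 0)"
proof -
  \<comment> \<open>At noise level 0 the bound is k * \<epsilon>, half of the permitted error.\<close>
  define k where "k = 1 + (\<tau> + 1) / (\<tau> - 1)"
  define \<epsilon> where "\<epsilon> = \<kappa> / (2 * k)"
  have k: "k > 0" using \<tau> by (simp add: k_def add_pos_pos)
  have "\<epsilon> > 0" using k \<kappa> by (simp add: \<epsilon>_def)
  moreover have "eventually (\<lambda>\<delta>. stopping_bound \<tau> \<epsilon> M \<delta> < \<kappa>) (at_right 0)" for M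
  proof -
    have "((\<lambda>\<delta>. stopping_bound \<tau> \<epsilon> M \<delta>) \<longlongrightarrow> stopping_bound \<tau> \<epsilon> M 0) (at_right 0)"
      using \<tau> unfolding stopping_bound_def by (intro tendsto_intros) auto
    moreover have "stopping_bound \<tau> \<epsilon> M 0 = \<epsilon> * k"
      by (simp add: stopping_bound_def k_def algebra_simps)
    then have "stopping_bound \<tau> \<epsilon> M 0 < \<kappa>" using k \<kappa> by (simp add: \<epsilon>_def)
    ultimately show ?thesis by (rule order_tendstoD)
  qed
  ultimately show ?thesis by (rule that)
qed

section \<open>Convergence of the stopped flow\<close>

theorem theorem2p9:
  fixes R :: "'a::banach \<Rightarrow> ereal"
    and A :: "'a \<Rightarrow>\<^sub>L 'b::{real_inner, banach}"
    and y :: 'b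
    and xdag :: 'a
    and yd :: "real \<Rightarrow> 'b"
    and x :: "real \<Rightarrow> real \<Rightarrow> 'a"
    and lam :: "real \<Rightarrow> real \<Rightarrow> 'b"
    and \<tau> :: real
  assumes "proper_functional R"
    and "lower_semicontinuous R"
    and "strongly_convex R"
    and "weakly_compact_sublevels R"
    and "\<exists>z\<in>effective_domain R. A z = y"
    and "is_arg_min R (\<lambda>z. A z = y) xdag"
    and "\<And>\<delta>. \<delta> > 0 \<Longrightarrow> norm (yd \<delta> - y) \<le> \<delta>"
    and "\<And>\<delta>. \<delta> > 0 \<Longrightarrow> dual_gradient_flow R A (yd \<delta>) (x \<delta>) (lam \<delta>)"
    and "\<tau> > 1"
  shows "(\<forall>\<delta>>0. \<exists>T. discrepancy_time A \<tau> \<delta> (yd \<delta>) (x \<delta>) T) \<and>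
    (\<forall>t :: real \<Rightarrow> real.
      (\<forall>\<delta>>0. discrepancy_time A \<tau> \<delta> (yd \<delta>) (x \<delta>) (t \<delta>)) \<longrightarrow>
        ((\<lambda>\<delta>. R (x \<delta> (t \<delta>))) \<longlongrightarrow> R xdag) (at_right 0) \<and>
        ((\<lambda>\<delta>. bregman_distance R (dual_adjoint A (lam \<delta> (t \<delta>))) xdag (x \<delta> (t \<delta>)))
           \<longlongrightarrow> 0) (at_right 0) \<and>
        ((\<lambda>\<delta>. norm (x \<delta> (t \<delta>) - xdag)) \<longlongrightarrow> 0) (at_right 0))"
proof -
  note proper = assms(1)
  let ?D = "effective_domain R" and ?f = "\<lambda>z. real_of_ereal (R z)"
  note fin = proper_on_domain(1)[OF proper]
  obtain c where sc: "strongly_convex_functional ?D ?f c"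
    using strongly_convex_functional_of_ereal[OF assms(1-3)] by blast
  interpret strongly_convex_functional ?D ?f c by (rule sc)
  have xdag: "A xdag = y" "\<And>z. A z = y \<Longrightarrow> R xdag \<le> R z"
    using assms(6) by (auto simp: is_arg_min_def not_less)
  have xdag_dom: "xdag \<in> ?D"
    using assms(5) xdag(2) by (auto simp: effective_domain_def intro: le_less_trans)
  have min: "?f xdag \<le> ?f z" if "z \<in> ?D" "A z = y" for z
    using xdag(2)[OF that(2)] fin[OF xdag_dom] fin[OF that(1)] by (metis ereal_less_eq(3))
  have flow: "noisy_dual_flow ?D ?f c A y (yd \<delta>) \<delta> xdag (x \<delta>) (lam \<delta>)" if \<delta>: "\<delta> > 0" for \<delta>
    using assms(8)[OF \<delta>] assms(7)[OF \<delta>] \<delta> xdag_dom xdag(1)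
    unfolding dual_gradient_flow_def conjugate_gradient_eq_dual_point[OF proper sc]
    by (intro noisy_dual_flow.intro sc noisy_dual_flow_axioms.intro) auto
  show ?thesis
  proof (intro conjI allI impI)
    fix \<delta> :: real assume "\<delta> > 0"
    then show "\<exists>T. discrepancy_time A \<tau> \<delta> (yd \<delta>) (x \<delta>) T"
      using noisy_dual_flow.discrepancy_time_exists[OF flow assms(9)] by blast
  next
    fix t :: "real \<Rightarrow> real"
    assume "\<forall>\<delta>>0. discrepancy_time A \<tau> \<delta> (yd \<delta>) (x \<delta>) (t \<delta>)"
    then have t: "discrepancy_time A \<tau> \<delta> (yd \<delta>) (x \<delta>) (t \<delta>)" if "\<delta> > 0" for \<delta> using that by blast
    define X where "X \<delta> = x \<delta> (t \<delta>)" for \<delta>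
    define G where "G \<delta> = ?f xdag + dual_objective A y (lam \<delta> (t \<delta>))" for \<delta>
    have t0: "t \<delta> \<ge> 0" if "\<delta> > 0" for \<delta>
      using noisy_dual_flow.discrepancy_time_props(1)[OF flow t] that by blast
    have X_dom: "X \<delta> \<in> ?D" if "\<delta> > 0" for \<delta>
      using noisy_dual_flow.x_eq[OF flow t0, OF that that] dual_point(1) by (simp add: X_def)
    have gap: "noisy_dual_flow.gap ?D ?f c A y xdag (lam \<delta>) (t \<delta>) = G \<delta>"
      if "\<delta> > 0" for \<delta>
      using noisy_dual_flow.gap_def[OF flow[OF that]] by (simp add: G_def)
    have pos: "eventually (\<lambda>\<delta>::real. \<delta> > 0) (at_right 0)" by (rule eventually_at_right_less)
    have close: "eventually (\<lambda>\<delta>. \<bar>G \<delta>\<bar> < \<kappa> \<and> \<bar>?f (X \<delta>) - ?f xdag\<bar> < \<kappa>) (at_right 0)"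
      if \<kappa>: "\<kappa> > 0" for \<kappa>
    proof -
      obtain \<epsilon> where \<epsilon>: "\<epsilon> > 0" "\<And>M. eventually (\<lambda>\<delta>. stopping_bound \<tau> \<epsilon> M \<delta> < \<kappa>) (at_right 0)"
        using stopping_bound_eventually_small[OF assms(9) \<kappa>] by blast
      obtain \<mu> where \<mu>: "dual_objective A y \<mu> < - ?f xdag + \<epsilon>"
        using strong_duality[OF xdag_dom xdag(1) min \<epsilon>(1)] by blast
      show ?thesis
        using pos \<epsilon>(2)[of "norm \<mu>"]
      proof eventually_elim
        case (elim \<delta>)
        note F = flow[OF elim(1)]
        show ?case
          using noisy_dual_flow.stopping_estimate[OF F assms(9) t[OF elim(1)] \<epsilon>(1) less_imp_le[OF \<mu>]]
            noisy_dual_flow.gap_nonneg[OF F t0[OF elim(1)]] elim(2)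
          unfolding gap[OF elim(1)] X_def by linarith
      qed
    qed
    have G_lim: "(G \<longlongrightarrow> 0) (at_right 0)"
      by (rule tendstoI, rule eventually_mono[OF close]) (auto simp: dist_real_def)
    have f_lim: "((\<lambda>\<delta>. ?f (X \<delta>)) \<longlongrightarrow> ?f xdag) (at_right 0)"
      by (rule tendstoI, rule eventually_mono[OF close]) (auto simp: dist_real_def)
    have "((\<lambda>\<delta>. ereal (?f (X \<delta>))) \<longlongrightarrow> R xdag) (at_right 0)"
      by (subst fin[OF xdag_dom]) (intro tendsto_ereal f_lim)
    then show "((\<lambda>\<delta>. R (x \<delta> (t \<delta>))) \<longlongrightarrow> R xdag) (at_right 0)"
      by (rule Lim_transform_eventually)
        (rule eventually_mono[OF pos], simp add: X_def fin[OF X_dom[unfolded X_def], symmetric])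
    have "bregman_distance R (dual_adjoint A (lam \<delta> (t \<delta>))) xdag (X \<delta>) = ereal (G \<delta>)"
      if \<delta>: "\<delta> > 0" for \<delta>
    proof -
      have "G \<delta> = ?f xdag - ?f (X \<delta>) - dual_adjoint A (lam \<delta> (t \<delta>)) (xdag - X \<delta>)"
        using noisy_dual_flow.gap_eq[OF flow[OF \<delta>] t0[OF \<delta>]]
        unfolding gap[OF \<delta>] by (simp add: X_def blinfun.diff_right inner_diff_right xdag(1))
      then show ?thesis
        unfolding bregman_distance_def
        by (subst fin[OF xdag_dom], subst fin[OF X_dom[OF \<delta>]]) simp
    qed
    note bregman = this
    have "((\<lambda>\<delta>. ereal (G \<delta>)) \<longlongrightarrow> 0) (at_right 0)"
      using tendsto_ereal[OF G_lim] by (simp add: zero_ereal_def)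
    then show "((\<lambda>\<delta>. bregman_distance R (dual_adjoint A (lam \<delta> (t \<delta>))) xdag (x \<delta> (t \<delta>)))
        \<longlongrightarrow> 0) (at_right 0)"
      by (rule Lim_transform_eventually)
        (rule eventually_mono[OF pos], simp add: bregman[unfolded X_def])
    have "eventually (\<lambda>\<delta>. norm (norm (X \<delta> - xdag)) \<le> sqrt (G \<delta> / c)) (at_right 0)"
      using pos
    proof eventually_elim
      case (elim \<delta>)
      have "(norm (X \<delta> - xdag))\<^sup>2 \<le> G \<delta> / c"
        using noisy_dual_flow.gap_ge[OF flow[OF elim] t0[OF elim]] c_pos
        unfolding gap[OF elim] by (simp add: X_def pos_le_divide_eq mult.commute)
      then show ?case using real_le_rsqrt by simp
    qed
    moreover have "((\<lambda>\<delta>. sqrt (G \<delta> / c)) \<longlongrightarrow> sqrt (0 / c)) (at_right 0)"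
      using c_pos by (intro tendsto_intros G_lim) auto
    ultimately have "((\<lambda>\<delta>. norm (X \<delta> - xdag)) \<longlongrightarrow> 0) (at_right 0)"
      by (intro Lim_null_comparison[of "\<lambda>\<delta>. norm (X \<delta> - xdag)"]) auto
    then show "((\<lambda>\<delta>. norm (x \<delta> (t \<delta>) - xdag)) \<longlongrightarrow> 0) (at_right 0)" by (simp add: X_def)
  qed
qed

end
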